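(* Let $G$ be a compact Lie group with normalized Haar measure $dg$, let $\widehat G$ be the set of equivalence classes of irreducible unitary representations of $G$, and for each $\lambda\in\widehat G$ fix a representative $\rho_\lambda:G\to U(d_\lambda)$ of dimension $d_\lambda$. Let $\widehat G_N\subset\widehat G$ be finite. Consider the finite-band harmonic exponential family of densities (with respect to $dg$) $$p_\theta(g)=\exp\left[E_\theta(g)-A(\theta)\right],\qquad E_\theta(g)=\sum_{\lambda\in\widehat G_N} d_\lambda\,\operatorname{Re}\operatorname{Tr}\left(C_\lambda^\dagger\rho_\lambda(g)\right),$$ with parameter $\theta=\{C_\lambda\}_{\lambda\in\widehat G_N}$, where each $C_\lambda$ is a complex $d_\lambda\times d_\lambda$ matrix, and $A(\theta)=\log\int_G e^{E_\theta(g)}\,dg$. Suppose that this family is full rank: after choosing real coordinates for the matrix coefficients, the natural statistic has no nontrivial affine dependence almost surely, and the natural parameter space contains a (nonempty) open set. Then, for i.i.d. observations $X_1,\dots,X_n\in G$ with density $p_\theta$, the statistic $$T_N(X_1,\dots,X_n)=\left(\sum_{i=1}^n\rho_\lambda(X_i)^\dagger\right)_{\lambda\in\widehat G_N}$$ is minimal sufficient for $\theta$.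
   Context: $\dagger$ denotes conjugate transpose. The parameter $\theta$ ranges over the parameter set $\Theta$ of the family. "Choosing real coordinates for the matrix coefficients" means choosing finitely many real-valued functions $t_1,\dots,t_m$ on $G$ that lie in and span the real vector space spanned by the real and imaginary parts of the entries of $\rho_\lambda$, $\lambda\in\widehat G_N$, and writing $E_\theta(g)=\sum_{j=1}^m\eta_j(\theta)t_j(g)$ with real natural parameters $\eta(\theta)=(\eta_1(\theta),\dots,\eta_m(\theta))$ depending real-linearly on the matrices $C_\lambda$; the natural statistic is $t=(t_1,\dots,t_m)$. "No nontrivial affine dependence almost surely" means: if $a\in\mathbb R^m$, $b\in\mathbb R$ and $\sum_j a_jt_j(g)=b$ for Haar-almost every $g\in G$, then $a=0$ and $b=0$. "The natural parameter space contains an open set" means that $\{\eta(\theta):\theta\in\Theta\}$ contains a nonempty open subset of $\mathbb R^m$. A statistic $T$ is sufficient for $\theta$ if the conditional distribution of the sample given $T$ does not depend on $\theta$; it is minimal sufficient if it is sufficient and is a function of every other sufficient statistic (up to null sets). *)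

theory Defs
  imports
    "HOL-Probability.Probability"
    "HOL-Algebra.Group"
    "Jordan_Normal_Form.Matrix"
    "Jordan_Normal_Form.Schur_Decomposition"
begin

text \<open>
  \<^const>\<open>Euclidean_space\<close> \<open>d\<close> is $\mathbb{R}^d$, carried by the functions
  \<open>nat \<Rightarrow> real\<close> that vanish from index \<open>d\<close> on. This keeps the dimension a number and
  allows \<open>d = 0\<close>, so finite groups are included. In \<open>Ck_on\<close> and \<open>smooth_on\<close> the set \<open>U\<close> is
  meant to be open in $\mathbb{R}^d$; only partial derivatives in the coordinates below \<open>d\<close> occur.
\<close>

primrec Ck_on :: "nat \<Rightarrow> nat \<Rightarrow> (nat \<Rightarrow> real) set \<Rightarrow> ((nat \<Rightarrow> real) \<Rightarrow> real) \<Rightarrow> bool" where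
  "Ck_on 0 d U f \<longleftrightarrow>
     continuous_map (subtopology (Euclidean_space d) U) euclideanreal f"
| "Ck_on (Suc k) d U f \<longleftrightarrow>
     continuous_map (subtopology (Euclidean_space d) U) euclideanreal f \<and>
     (\<forall>i<d. (\<forall>x\<in>U. (\<lambda>s. f (x(i := s))) differentiable (at (x i))) \<and>
            Ck_on k d U (\<lambda>x. deriv (\<lambda>s. f (x(i := s))) (x i)))"

definition smooth_on ::
    "nat \<Rightarrow> nat \<Rightarrow> (nat \<Rightarrow> real) set \<Rightarrow> ((nat \<Rightarrow> real) \<Rightarrow> nat \<Rightarrow> real) \<Rightarrow> bool" where
  "smooth_on d e U f \<longleftrightarrow> (\<forall>k. \<forall>j<e. Ck_on k d U (\<lambda>x. f x j))"

type_synonym 'a chart = "'a set \<times> ('a \<Rightarrow> nat \<Rightarrow> real)"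

definition smooth_manifold :: "'a topology \<Rightarrow> nat \<Rightarrow> 'a chart set \<Rightarrow> bool" where
  "smooth_manifold X d \<A> \<longleftrightarrow>
     Hausdorff_space X \<and> second_countable X \<and>
     (\<Union>(U, \<phi>)\<in>\<A>. U) = topspace X \<and>
     (\<forall>(U, \<phi>)\<in>\<A>. openin X U \<and> openin (Euclidean_space d) (\<phi> ` U) \<and>
        homeomorphic_map (subtopology X U) (subtopology (Euclidean_space d) (\<phi> ` U)) \<phi>) \<and>
     (\<forall>(U, \<phi>)\<in>\<A>. \<forall>(V, \<psi>)\<in>\<A>. smooth_on d d (\<phi> ` (U \<inter> V)) (\<psi> \<circ> inv_into U \<phi>))"

definition prod_atlas ::
    "nat \<Rightarrow> 'a chart set \<Rightarrow> 'b chart set \<Rightarrow> ('a \<times> 'b) chart set" where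
  "prod_atlas d \<A> \<B> =
     {(U \<times> V, \<lambda>(x, y) i. if i < d then \<phi> x i else \<psi> y (i - d)) | U \<phi> V \<psi>.
        (U, \<phi>) \<in> \<A> \<and> (V, \<psi>) \<in> \<B>}"

definition smooth_map ::
    "'a topology \<Rightarrow> nat \<Rightarrow> 'a chart set \<Rightarrow> 'b topology \<Rightarrow> nat \<Rightarrow> 'b chart set \<Rightarrow>
     ('a \<Rightarrow> 'b) \<Rightarrow> bool" where
  "smooth_map X d \<A> Y e \<B> f \<longleftrightarrow>
     continuous_map X Y f \<and>
     (\<forall>(U, \<phi>)\<in>\<A>. \<forall>(V, \<psi>)\<in>\<B>.
        smooth_on d e (\<phi> ` (U \<inter> f -` V)) (\<psi> \<circ> f \<circ> inv_into U \<phi>))"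

definition lie_group :: "('g, 'r) monoid_scheme \<Rightarrow> 'g topology \<Rightarrow> nat \<Rightarrow> 'g chart set \<Rightarrow> bool" where
  "lie_group G X d \<A> \<longleftrightarrow>
     group G \<and> topspace X = carrier G \<and> smooth_manifold X d \<A> \<and>
     smooth_map (prod_topology X X) (d + d) (prod_atlas d \<A> \<A>) X d \<A>
       (\<lambda>(x, y). x \<otimes>\<^bsub>G\<^esub> y) \<and>
     smooth_map X d \<A> X d \<A> (\<lambda>x. inv\<^bsub>G\<^esub> x)"

text \<open>
  On a compact group left invariance implies right invariance, and on a second-countable
  compact Hausdorff space a finite Borel measure is regular, so neither is required separately.
\<close>

definition normalized_haar :: "('g, 'r) monoid_scheme \<Rightarrow> 'g topology \<Rightarrow> 'g measure \<Rightarrow> bool" where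
  "normalized_haar G X \<mu> \<longleftrightarrow>
     space \<mu> = topspace X \<and> sets \<mu> = sigma_sets (topspace X) {U. openin X U} \<and>
     prob_space \<mu> \<and>
     (\<forall>g\<in>carrier G. distr \<mu> \<mu> (\<lambda>h. g \<otimes>\<^bsub>G\<^esub> h) = \<mu>)"

definition mat_trace :: "complex mat \<Rightarrow> complex" where
  "mat_trace A = (\<Sum>i<dim_row A. A $$ (i, i))"

text \<open>A representation of dimension \<open>d\<close> is a pair \<open>(d, \<rho>)\<close>.\<close>

type_synonym 'g rep = "nat \<times> ('g \<Rightarrow> complex mat)"

definition unitary_rep :: "('g, 'r) monoid_scheme \<Rightarrow> 'g topology \<Rightarrow> 'g rep \<Rightarrow> bool" where
  "unitary_rep G X = (\<lambda>(d, \<rho>).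
     (\<forall>g\<in>carrier G. \<rho> g \<in> carrier_mat d d \<and>
        \<rho> g * mat_adjoint (\<rho> g) = 1\<^sub>m d \<and> mat_adjoint (\<rho> g) * \<rho> g = 1\<^sub>m d) \<and>
     (\<forall>g\<in>carrier G. \<forall>h\<in>carrier G. \<rho> (g \<otimes>\<^bsub>G\<^esub> h) = \<rho> g * \<rho> h) \<and>
     (\<forall>i<d. \<forall>j<d. continuous_map X euclidean (\<lambda>g. \<rho> g $$ (i, j))))"

definition invariant_subspace :: "('g, 'r) monoid_scheme \<Rightarrow> 'g rep \<Rightarrow> complex vec set \<Rightarrow> bool" where
  "invariant_subspace G = (\<lambda>(d, \<rho>) W.
     W \<subseteq> carrier_vec d \<and> 0\<^sub>v d \<in> W \<and>
     (\<forall>v\<in>W. \<forall>w\<in>W. v + w \<in> W) \<and> (\<forall>c. \<forall>v\<in>W. c \<cdot>\<^sub>v v \<in> W) \<and>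
     (\<forall>g\<in>carrier G. \<forall>v\<in>W. \<rho> g *\<^sub>v v \<in> W))"

definition irreps :: "('g, 'r) monoid_scheme \<Rightarrow> 'g topology \<Rightarrow> 'g rep set" where
  "irreps G X = {(d, \<rho>). unitary_rep G X (d, \<rho>) \<and> 0 < d \<and>
     (\<forall>W. invariant_subspace G (d, \<rho>) W \<longrightarrow> W = {0\<^sub>v d} \<or> W = carrier_vec d)}"

definition rep_equiv :: "('g, 'r) monoid_scheme \<Rightarrow> 'g topology \<Rightarrow> ('g rep \<times> 'g rep) set" where
  "rep_equiv G X = {((d, \<rho>), (e, \<sigma>)). (d, \<rho>) \<in> irreps G X \<and> (e, \<sigma>) \<in> irreps G X \<and> d = e \<and>
     (\<exists>P\<in>carrier_mat d d. invertible_mat P \<and> (\<forall>g\<in>carrier G. P * \<rho> g = \<sigma> g * P))}"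

definition unitary_dual :: "('g, 'r) monoid_scheme \<Rightarrow> 'g topology \<Rightarrow> 'g rep set set" where
  "unitary_dual G X = irreps G X // rep_equiv G X"

text \<open>Families $\{C_\lambda\}_{\lambda\in\Lambda}$ are extensional functions on \<open>\<Lambda>\<close>.\<close>

definition coeff_families :: "'l set \<Rightarrow> ('l \<Rightarrow> nat) \<Rightarrow> ('l \<Rightarrow> complex mat) set" where
  "coeff_families \<Lambda> d = (\<Pi>\<^sub>E l\<in>\<Lambda>. carrier_mat (d l) (d l))"

definition harmonic_energy ::
    "'l set \<Rightarrow> ('l \<Rightarrow> nat) \<Rightarrow> ('l \<Rightarrow> 'g \<Rightarrow> complex mat) \<Rightarrow> ('l \<Rightarrow> complex mat) \<Rightarrow> 'g \<Rightarrow> real" where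
  "harmonic_energy \<Lambda> d \<rho> C g =
     (\<Sum>l\<in>\<Lambda>. real (d l) * Re (mat_trace (mat_adjoint (C l) * \<rho> l g)))"

definition log_partition ::
    "'g measure \<Rightarrow> 'l set \<Rightarrow> ('l \<Rightarrow> nat) \<Rightarrow> ('l \<Rightarrow> 'g \<Rightarrow> complex mat) \<Rightarrow>
     ('l \<Rightarrow> complex mat) \<Rightarrow> real" where
  "log_partition \<mu> \<Lambda> d \<rho> C = ln (\<integral>g. exp (harmonic_energy \<Lambda> d \<rho> C g) \<partial>\<mu>)"

definition harmonic_density ::
    "'g measure \<Rightarrow> 'l set \<Rightarrow> ('l \<Rightarrow> nat) \<Rightarrow> ('l \<Rightarrow> 'g \<Rightarrow> complex mat) \<Rightarrow>
     ('l \<Rightarrow> complex mat) \<Rightarrow> 'g \<Rightarrow> real" where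
  "harmonic_density \<mu> \<Lambda> d \<rho> C g =
     exp (harmonic_energy \<Lambda> d \<rho> C g - log_partition \<mu> \<Lambda> d \<rho> C)"

text \<open>The joint law of \<open>n\<close> i.i.d. observations; a sample is an extensional function on \<open>{..<n}\<close>.\<close>

definition sample_law ::
    "nat \<Rightarrow> 'g measure \<Rightarrow> 'l set \<Rightarrow> ('l \<Rightarrow> nat) \<Rightarrow> ('l \<Rightarrow> 'g \<Rightarrow> complex mat) \<Rightarrow>
     ('l \<Rightarrow> complex mat) \<Rightarrow> (nat \<Rightarrow> 'g) measure" where
  "sample_law n \<mu> \<Lambda> d \<rho> C =
     (\<Pi>\<^sub>M i\<in>{..<n}. density \<mu> (\<lambda>g. ennreal (harmonic_density \<mu> \<Lambda> d \<rho> C g)))"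

definition real_span :: "'g set \<Rightarrow> ('g \<Rightarrow> real) set \<Rightarrow> ('g \<Rightarrow> real) set" where
  "real_span S F = {f. \<exists>B c. finite B \<and> B \<subseteq> F \<and> (\<forall>g\<in>S. f g = (\<Sum>b\<in>B. c b * b g))}"

definition matrix_coefficients ::
    "'l set \<Rightarrow> ('l \<Rightarrow> nat) \<Rightarrow> ('l \<Rightarrow> 'g \<Rightarrow> complex mat) \<Rightarrow> ('g \<Rightarrow> real) set" where
  "matrix_coefficients \<Lambda> d \<rho> =
     (\<Union>l\<in>\<Lambda>. \<Union>i\<in>{..<d l}. \<Union>j\<in>{..<d l}.
        {\<lambda>g. Re (\<rho> l g $$ (i, j)), \<lambda>g. Im (\<rho> l g $$ (i, j))})"

definition real_linear_coords ::
    "'l set \<Rightarrow> ('l \<Rightarrow> nat) \<Rightarrow> nat \<Rightarrow> (('l \<Rightarrow> complex mat) \<Rightarrow> nat \<Rightarrow> real) \<Rightarrow> bool" where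
  "real_linear_coords \<Lambda> d m \<eta> \<longleftrightarrow>
     (\<forall>C\<in>coeff_families \<Lambda> d. \<forall>D\<in>coeff_families \<Lambda> d. \<forall>j<m.
        \<eta> (\<lambda>l\<in>\<Lambda>. C l + D l) j = \<eta> C j + \<eta> D j) \<and>
     (\<forall>r::real. \<forall>C\<in>coeff_families \<Lambda> d. \<forall>j<m.
        \<eta> (\<lambda>l\<in>\<Lambda>. complex_of_real r \<cdot>\<^sub>m C l) j = r * \<eta> C j)"

text \<open>\<open>t\<^sub>0, \<dots>, t\<^sub>m\<^sub>-\<^sub>1\<close> is the natural statistic, \<open>\<eta>\<close> the natural parameter.\<close>

definition real_coordinates ::
    "'g set \<Rightarrow> 'l set \<Rightarrow> ('l \<Rightarrow> nat) \<Rightarrow> ('l \<Rightarrow> 'g \<Rightarrow> complex mat) \<Rightarrow> nat \<Rightarrow>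
     (nat \<Rightarrow> 'g \<Rightarrow> real) \<Rightarrow> (('l \<Rightarrow> complex mat) \<Rightarrow> nat \<Rightarrow> real) \<Rightarrow> bool" where
  "real_coordinates S \<Lambda> d \<rho> m t \<eta> \<longleftrightarrow>
     real_span S (t ` {..<m}) = real_span S (matrix_coefficients \<Lambda> d \<rho>) \<and>
     real_linear_coords \<Lambda> d m \<eta> \<and>
     (\<forall>C\<in>coeff_families \<Lambda> d. \<forall>g\<in>S. harmonic_energy \<Lambda> d \<rho> C g = (\<Sum>j<m. \<eta> C j * t j g))"

definition full_rank ::
    "'g measure \<Rightarrow> 'l set \<Rightarrow> ('l \<Rightarrow> nat) \<Rightarrow> ('l \<Rightarrow> 'g \<Rightarrow> complex mat) \<Rightarrow>
     ('l \<Rightarrow> complex mat) set \<Rightarrow> bool" where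
  "full_rank \<mu> \<Lambda> d \<rho> \<Theta> \<longleftrightarrow>
     (\<exists>m t \<eta>. real_coordinates (space \<mu>) \<Lambda> d \<rho> m t \<eta> \<and>
        (\<forall>a b. (AE g in \<mu>. (\<Sum>j<m. a j * t j g) = b) \<longrightarrow> (\<forall>j<m. a j = 0) \<and> b = 0) \<and>
        (\<exists>U. openin (Euclidean_space m) U \<and> U \<noteq> {} \<and>
             U \<subseteq> (\<lambda>C j. if j < m then \<eta> C j else 0) ` \<Theta>))"

text \<open>
  \<open>P\<close> is a family of laws on the measurable space \<open>M\<close>, and \<open>T\<close> a statistic with values in the
  measurable space \<open>N\<close>. The kernel \<open>K\<close> is a regular conditional distribution of the sample
  given \<open>T\<close>, the same for all parameters.
\<close>

definition sufficient ::
    "'x measure \<Rightarrow> 'p set \<Rightarrow> ('p \<Rightarrow> 'x measure) \<Rightarrow> 's measure \<Rightarrow> ('x \<Rightarrow> 's) \<Rightarrow> bool" where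
  "sufficient M \<Theta> P N T \<longleftrightarrow>
     T \<in> M \<rightarrow>\<^sub>M N \<and>
     (\<exists>K \<in> N \<rightarrow>\<^sub>M prob_algebra M. \<forall>\<theta>\<in>\<Theta>. \<forall>A\<in>sets M. \<forall>B\<in>sets N.
        emeasure (P \<theta>) (A \<inter> (T -` B \<inter> space M)) =
        (\<integral>\<^sup>+ y\<in>B. emeasure (K y) A \<partial>distr (P \<theta>) N T))"

text \<open>
  The type argument is the type in which the competing statistics \<open>S\<close> take their values; keeping
  it a type variable in a theorem lets it range over all types.
\<close>

definition minimal_sufficient ::
    "'s itself \<Rightarrow> 'x measure \<Rightarrow> 'p set \<Rightarrow> ('p \<Rightarrow> 'x measure) \<Rightarrow> 't measure \<Rightarrow>
     ('x \<Rightarrow> 't) \<Rightarrow> bool" where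
  "minimal_sufficient _ M \<Theta> P N T \<longleftrightarrow>
     sufficient M \<Theta> P N T \<and>
     (\<forall>(N' :: 's measure) S. sufficient M \<Theta> P N' S \<longrightarrow>
        (\<exists>h \<in> N' \<rightarrow>\<^sub>M N. \<forall>\<theta>\<in>\<Theta>. AE x in P \<theta>. T x = h (S x)))"

text \<open>The Borel \<open>\<sigma>\<close>-algebra on $\mathbb{C}^{d\times d}$, generated by the matrix entries.\<close>

definition mat_borel :: "nat \<Rightarrow> complex mat measure" where
  "mat_borel d = vimage_algebra (carrier_mat d d)
     (\<lambda>A. \<lambda>ij\<in>{..<d} \<times> {..<d}. A $$ ij) (\<Pi>\<^sub>M ij\<in>{..<d} \<times> {..<d}. borel)"

definition harmonic_stat_space :: "'l set \<Rightarrow> ('l \<Rightarrow> nat) \<Rightarrow> ('l \<Rightarrow> complex mat) measure" where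
  "harmonic_stat_space \<Lambda> d = (\<Pi>\<^sub>M l\<in>\<Lambda>. mat_borel (d l))"

definition harmonic_stat ::
    "nat \<Rightarrow> 'l set \<Rightarrow> ('l \<Rightarrow> nat) \<Rightarrow> ('l \<Rightarrow> 'g \<Rightarrow> complex mat) \<Rightarrow> (nat \<Rightarrow> 'g) \<Rightarrow>
     'l \<Rightarrow> complex mat" where
  "harmonic_stat n \<Lambda> d \<rho> x =
     (\<lambda>l\<in>\<Lambda>. mat (d l) (d l) (\<lambda>ij. \<Sum>i<n. mat_adjoint (\<rho> l (x i)) $$ ij))"

end

theory Submission
  imports Defs
begin

text \<open>
  Sufficiency. The energy of a sample is a linear functional of the statistic: summing
  $\operatorname{Re}\operatorname{Tr}(C_\lambda^\dagger\rho_\lambda(x_i))$ over \<open>i\<close> gives an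
  expression in the matrices $\sum_i\rho_\lambda(x_i)^\dagger$ alone (\<open>sum_harmonic_energy\<close>). All
  sample laws therefore have, with respect to the \<open>n\<close>-fold power of Haar measure, densities that are
  constant on the fibres of the statistic, and the conditional distribution of that one reference
  measure given the statistic is a conditional distribution under every parameter
  (\<open>sufficient_if_density_factors\<close>). What has to be constructed is this conditional distribution as
  a kernel (\<open>regular_conditional_distribution\<close>). The topology of the group enters here: a nonempty
  compact Hausdorff second-countable space is, as a Borel space, a retract of the space of bit sequences,
  hence so is its \<open>n\<close>-fold product, and the bit sequences are a retract of the unit interval. On
  the interval a conditional distribution is given by conditional distribution functions, which are
  assembled from Radon-Nikodym derivatives at rational points.

  Minimality. Let \<open>S\<close> be sufficient. Under two parameters the conditional distribution given \<open>S\<close> is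
  the same, so the two laws of the sample differ only through the two laws of \<open>S\<close>, and the
  likelihood ratio is a function of \<open>S\<close> (\<open>sufficient_likelihood_ratio\<close>). A nonempty open set of
  natural parameters contains, for each coordinate \<open>j\<close>, two points that differ in that coordinate only; the
  logarithm of their likelihood ratio is, up to a constant, a nonzero multiple of
  $\sum_i t_j(x_i)$. So each of these sums is almost surely a function of \<open>S\<close>
  (\<open>exponential_family_statistic_factors\<close>). The matrix coefficients lie in the span of the $t_j$,
  whence the harmonic statistic is a linear image of the vector of these sums
  (\<open>harmonic_stat_linear_in_sums\<close>), and so it is a function of \<open>S\<close> as well.
\<close>

section \<open>Compact Borel spaces as retracts of the unit interval\<close>

text \<open>
  The map \<open>\<psi>\<close> is what transports measures back from \<open>N\<close> to \<open>M\<close>, so it has to be defined and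
  measurable on all of \<open>N\<close>, not only on the image of \<open>\<phi>\<close>.
\<close>

definition measurable_retract :: "'a measure \<Rightarrow> 'b measure \<Rightarrow> bool" where
  "measurable_retract M N \<longleftrightarrow>
     (\<exists>\<phi> \<in> M \<rightarrow>\<^sub>M N. \<exists>\<psi> \<in> N \<rightarrow>\<^sub>M M. \<forall>x\<in>space M. \<psi> (\<phi> x) = x)"

definition bit_space :: "(nat \<Rightarrow> bool) measure" where
  "bit_space = (\<Pi>\<^sub>M k\<in>UNIV. count_space UNIV)"

lemma space_bit_space [simp]: "space bit_space = UNIV"
  by (simp add: bit_space_def space_PiM PiE_UNIV_domain)

lemma measurable_bit [measurable]: "(\<lambda>a. a k) \<in> bit_space \<rightarrow>\<^sub>M count_space UNIV"
  unfolding bit_space_def by (rule measurable_component_singleton) simp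

lemma measurable_into_bit_space:
  assumes "\<And>k. Measurable.pred M (\<lambda>x. f x k)"
  shows "f \<in> M \<rightarrow>\<^sub>M bit_space"
  unfolding bit_space_def using assms by (intro measurable_PiM_single') auto

text \<open>
  A point is encoded by the set of members of a countable base that contain it. The set of codes is
  measurable because it is described by countably many conditions: every finite initial segment of
  the code is realised by some point, and every base set in the code contains the closure of
  another one in the code. Given both, compactness yields a point that lies in all closures of base
  sets in the code and outside the base sets not in it; the second condition turns closures back
  into base sets.
\<close>

lemma compact_Hausdorff_measurable_retract:
  assumes compact: "compact_space X" and Hausdorff: "Hausdorff_space X"
    and countable: "second_countable X" and ne: "topspace X \<noteq> {}"
    and space: "space \<mu> = topspace X"
    and sets: "sets \<mu> = sigma_sets (topspace X) {U. openin X U}"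
  shows "measurable_retract \<mu> bit_space"
proof -
  obtain \<B> where "countable \<B> \<and> (\<forall>V\<in>\<B>. openin X V) \<and>
      (\<forall>U x. openin X U \<and> x \<in> U \<longrightarrow> (\<exists>V\<in>\<B>. x \<in> V \<and> V \<subseteq> U))"
    using countable unfolding second_countable_def by (rule exE)
  then have \<B>: "countable \<B>" "\<And>V. V \<in> \<B> \<Longrightarrow> openin X V"
    "\<And>U x. openin X U \<Longrightarrow> x \<in> U \<Longrightarrow> \<exists>V\<in>\<B>. x \<in> V \<and> V \<subseteq> U"
    by simp_all
  have "\<B> \<noteq> {}" using ne \<B>(3)[OF openin_topspace] by blast
  define U where "U = from_nat_into \<B>"
  have openU: "openin X (U k)" for k
    unfolding U_def using \<B>(2) from_nat_into[OF \<open>\<B> \<noteq> {}\<close>] by blast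
  have baseU: "\<exists>k. x \<in> U k \<and> U k \<subseteq> V" if V: "openin X V" "x \<in> V" for V x
  proof -
    obtain W where "W \<in> \<B>" "x \<in> W" "W \<subseteq> V" using \<B>(3)[OF V] by blast
    then show ?thesis unfolding U_def using from_nat_into_surj[OF \<B>(1), of W] by auto
  qed
  have setU[measurable]: "U k \<in> sets \<mu>" for k
    unfolding sets using openU by (auto intro: sigma_sets.Basic)
  have separated: "x = y" if xy: "x \<in> topspace X" "y \<in> topspace X" "\<And>k. x \<in> U k \<longleftrightarrow> y \<in> U k" for x y
  proof (rule ccontr)
    assume "x \<noteq> y"
    then obtain V W where "openin X V" "openin X W" "x \<in> V" "y \<in> W" "disjnt V W"
      using Hausdorff xy(1,2) unfolding Hausdorff_space_def by metis
    then show False using baseU[of V x] xy(3) by (auto simp: disjnt_def)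
  qed
  \<comment> \<open>Regularity: this is the second condition in the description of the codes.\<close>
  have shrink: "\<exists>j. x \<in> U j \<and> X closure_of U j \<subseteq> U k" if x: "x \<in> U k" for x k
  proof -
    have "neighbourhood_base_of (closedin X) X"
      using compact_Hausdorff_imp_regular_space[OF compact Hausdorff]
      by (simp add: neighbourhood_base_of_closedin)
    then obtain V C where "openin X V" "closedin X C" "x \<in> V" "V \<subseteq> C" "C \<subseteq> U k"
      using openU[of k] x unfolding neighbourhood_base_of by metis
    moreover obtain j where "x \<in> U j" "U j \<subseteq> V" using baseU calculation by blast
    ultimately show ?thesis by (meson closure_of_minimal order_trans)
  qed
  define \<phi> where "\<phi> x k \<longleftrightarrow> x \<in> U k" for x k
  define I where "I = {a.
    (\<forall>n. \<exists>S\<in>(\<lambda>x. {k \<in> {..n}. x \<in> U k}) ` topspace X. \<forall>k\<in>{..n}. a k \<longleftrightarrow> k \<in> S) \<and>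
    (\<forall>k. a k \<longrightarrow> (\<exists>j. a j \<and> X closure_of U j \<subseteq> U k))}"
  have fin: "finite ((\<lambda>x. {k \<in> {..n}. x \<in> U k}) ` topspace X)" for n
    by (rule finite_subset[of _ "Pow {..n}"]) auto
  have I_meas[measurable]: "Measurable.pred bit_space (\<lambda>a. a \<in> I)"
    unfolding I_def mem_Collect_eq using fin by measurable
  have \<phi>_I: "\<phi> x \<in> I" if "x \<in> topspace X" for x
    unfolding I_def \<phi>_def using that shrink by auto
  have I_atom: "\<exists>x\<in>topspace X. \<forall>k\<le>n. a k \<longleftrightarrow> x \<in> U k" if "a \<in> I" for a n
  proof -
    have "\<exists>S\<in>(\<lambda>x. {k \<in> {..n}. x \<in> U k}) ` topspace X. \<forall>k\<in>{..n}. a k \<longleftrightarrow> k \<in> S"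
      using that unfolding I_def mem_Collect_eq by (elim conjE) (erule spec)
    then show ?thesis by (simp add: Ball_def)
  qed
  have I_shrink: "\<exists>j. a j \<and> X closure_of U j \<subseteq> U k" if "a \<in> I" "a k" for a k
    using that unfolding I_def by simp
  have "\<exists>x. x \<in> topspace X \<and> \<phi> x = a" if "a \<in> I" for a
  proof -
    \<comment> \<open>A decreasing sequence of nonempty closed sets, whose common points have code \<open>a\<close>.\<close>
    define C where "C n = topspace X \<inter> (\<Inter>j\<in>{..n}. if a j then X closure_of U j else topspace X - U j)" for n
    have C_iff: "x \<in> C n \<longleftrightarrow> x \<in> topspace X \<and>
        (\<forall>j\<in>{..n}. x \<in> (if a j then X closure_of U j else topspace X - U j))" for x n
      by (simp only: C_def Int_iff INT_iff)
    have "\<Inter> (range C) \<noteq> {}"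
    proof (rule compact_space_imp_nest[OF compact])
      show "closedin X (C n)" for n
        unfolding C_def using openU by (intro closedin_Int closedin_INT) auto
      show "C n \<noteq> {}" for n
      proof -
        obtain x where x: "x \<in> topspace X" "\<forall>k\<le>n. a k \<longleftrightarrow> x \<in> U k"
          using I_atom[OF \<open>a \<in> I\<close>, of n] by auto
        have "x \<in> (if a j then X closure_of U j else topspace X - U j)" if "j \<in> {..n}" for j
          using x that closure_of_subset[OF openin_subset[OF openU[of j]]] by auto
        then have "x \<in> C n"
          unfolding C_def using x(1) by blast
        then show ?thesis by blast
      qed
      show "decseq C"
        unfolding C_def decseq_def by (intro allI impI Int_mono INF_superset_mono) auto
    qed
    then obtain x where x: "\<And>n. x \<in> C n" by auto
    have xT: "x \<in> topspace X" using x[of 0] unfolding C_iff by (rule conjunct1)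
    have xU: "x \<in> (if a j then X closure_of U j else topspace X - U j)" for j
      using x[of j, unfolded C_iff, THEN conjunct2] by (rule bspec) simp
    have "\<phi> x j = a j" for j
    proof (cases "a j")
      case True
      obtain i where i: "a i \<and> X closure_of U i \<subseteq> U j"
        using I_shrink[OF \<open>a \<in> I\<close> True] by (rule exE)
      then have "x \<in> X closure_of U i" using xU[of i] by simp
      then have "x \<in> U j" using i by blast
      then show ?thesis using True by (simp add: \<phi>_def)
    next
      case False
      then show ?thesis using xU[of j] by (simp add: \<phi>_def)
    qed
    then show ?thesis using xT by auto
  qed
  then obtain \<xi> where \<xi>: "\<And>a. a \<in> I \<Longrightarrow> \<xi> a \<in> topspace X \<and> \<phi> (\<xi> a) = a" by metis
  obtain x0 where x0: "x0 \<in> topspace X" using ne by blast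
  define \<psi> where "\<psi> a = (if a \<in> I then \<xi> a else x0)" for a
  have "\<phi> \<in> \<mu> \<rightarrow>\<^sub>M bit_space"
    by (rule measurable_into_bit_space) (simp add: \<phi>_def)
  moreover have "\<psi> \<in> bit_space \<rightarrow>\<^sub>M \<mu>"
  proof (rule measurable_sigma_sets[OF sets])
    show "{U. openin X U} \<subseteq> Pow (topspace X)" using openin_subset by auto
    show "\<psi> \<in> space bit_space \<rightarrow> topspace X" using \<xi> x0 by (auto simp: \<psi>_def)
    fix V assume "V \<in> {U. openin X U}"
    then have V: "V = (\<Union>k\<in>{k. U k \<subseteq> V}. U k)" using baseU by blast
    have eq: "\<psi> -` U k \<inter> space bit_space = {a\<in>space bit_space. if a \<in> I then a k else x0 \<in> U k}" for k
      using \<xi> by (auto simp: \<psi>_def \<phi>_def fun_eq_iff)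
    have "\<psi> -` U k \<inter> space bit_space \<in> sets bit_space" for k
      unfolding eq by measurable
    then have "(\<Union>k\<in>{k. U k \<subseteq> V}. \<psi> -` U k \<inter> space bit_space) \<in> sets bit_space"
      by (intro sets.countable_UN) auto
    also have "(\<Union>k\<in>{k. U k \<subseteq> V}. \<psi> -` U k \<inter> space bit_space) = \<psi> -` V \<inter> space bit_space"
      by (subst (2) V) auto
    finally show "\<psi> -` V \<inter> space bit_space \<in> sets bit_space" .
  qed
  moreover have "\<psi> (\<phi> x) = x" if "x \<in> space \<mu>" for x
    using that \<phi>_I[of x] \<xi>[of "\<phi> x"] separated[of "\<xi> (\<phi> x)" x]
    by (auto simp: space \<psi>_def \<phi>_def fun_eq_iff)
  ultimately show ?thesis unfolding measurable_retract_def by blast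
qed

lemma measurable_retract_PiM:
  fixes I :: "nat set"
  assumes "measurable_retract M bit_space"
  shows "measurable_retract (\<Pi>\<^sub>M i\<in>I. M) bit_space"
proof -
  obtain \<phi> \<psi> where \<phi>[measurable]: "\<phi> \<in> M \<rightarrow>\<^sub>M bit_space" and \<psi>[measurable]: "\<psi> \<in> bit_space \<rightarrow>\<^sub>M M"
    and inv: "\<And>x. x \<in> space M \<Longrightarrow> \<psi> (\<phi> x) = x"
    using assms unfolding measurable_retract_def by blast
  define \<Phi> where "\<Phi> x k = (fst (prod_decode k) \<in> I \<and> \<phi> (x (fst (prod_decode k))) (snd (prod_decode k)))" for x k
  define \<Psi> where "\<Psi> a = (\<lambda>i\<in>I. \<psi> (\<lambda>j. a (prod_encode (i, j))))" for a
  have "\<Phi> \<in> (\<Pi>\<^sub>M i\<in>I. M) \<rightarrow>\<^sub>M bit_space"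
  proof (rule measurable_into_bit_space)
    fix k
    show "Measurable.pred (\<Pi>\<^sub>M i\<in>I. M) (\<lambda>x. \<Phi> x k)"
    proof (cases "fst (prod_decode k) \<in> I")
      case True
      have [measurable]: "(\<lambda>x. x (fst (prod_decode k))) \<in> (\<Pi>\<^sub>M i\<in>I. M) \<rightarrow>\<^sub>M M"
        using True by (rule measurable_component_singleton)
      show ?thesis unfolding \<Phi>_def by measurable
    qed (simp add: \<Phi>_def)
  qed
  moreover have "\<Psi> \<in> bit_space \<rightarrow>\<^sub>M (\<Pi>\<^sub>M i\<in>I. M)"
    unfolding \<Psi>_def
    by (intro measurable_restrict measurable_compose[OF _ \<psi>] measurable_into_bit_space) measurable
  moreover have "\<Psi> (\<Phi> x) = x" if "x \<in> space (\<Pi>\<^sub>M i\<in>I. M)" for x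
  proof
    fix i show "\<Psi> (\<Phi> x) i = x i"
      using that inv by (cases "i \<in> I") (auto simp: \<Psi>_def \<Phi>_def space_PiM PiE_iff extensional_def)
  qed
  ultimately show ?thesis unfolding measurable_retract_def by blast
qed

text \<open>
  Base 3 with digits 0 and 1 only: the tail of an expansion is at most half a unit of the preceding
  digit, so digits can be read off by comparison, without the ambiguity of binary expansions.
\<close>

definition ternary :: "(nat \<Rightarrow> bool) \<Rightarrow> real" where
  "ternary a = (\<Sum>k. of_bool (a k) * (1 / 3) ^ Suc k)"

lemma summable_ternary: "summable (\<lambda>k. of_bool (a k) * (1 / 3 :: real) ^ Suc k)"
  by (rule summable_comparison_test'[where g = "\<lambda>k. (1/3) ^ k" and N = 0]) (auto simp: summable_geometric)

lemma ternary_bounds: "0 \<le> ternary a" "ternary a \<le> 1 / 2"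
proof -
  have "(\<lambda>k. (1 / 3 :: real) * (1 / 3) ^ k) sums (1 / 3 * (1 / (1 - 1 / 3)))"
    by (intro sums_mult geometric_sums) simp
  then have geo: "(\<lambda>k. (1 / 3 :: real) ^ Suc k) sums (1 / 2)" by simp
  show "0 \<le> ternary a"
    unfolding ternary_def by (intro suminf_nonneg summable_ternary) simp
  have "ternary a \<le> (\<Sum>k. (1 / 3) ^ Suc k)"
    unfolding ternary_def using geo
    by (intro suminf_le summable_ternary) (auto simp: sums_iff)
  then show "ternary a \<le> 1 / 2" using geo by (simp add: sums_iff)
qed

lemma ternary_shift: "3 * ternary a = of_bool (a 0) + ternary (\<lambda>k. a (Suc k))"
proof -
  have "ternary a = of_bool (a 0) / 3 + (\<Sum>k. of_bool (a (Suc k)) * (1 / 3) ^ Suc (Suc k))"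
    unfolding ternary_def using suminf_split_head[OF summable_ternary[of a]] by simp
  also have "(\<Sum>k. of_bool (a (Suc k)) * (1 / 3 :: real) ^ Suc (Suc k)) =
      (\<Sum>k. (of_bool (a (Suc k)) * (1 / 3) ^ Suc k) * (1 / 3))"
    by (rule suminf_cong) simp
  also have "\<dots> = ternary (\<lambda>k. a (Suc k)) * (1 / 3)"
    unfolding ternary_def by (rule suminf_mult2[symmetric]) (rule summable_ternary)
  finally show ?thesis by simp
qed

lemma ternary_head: "1 \<le> 3 * ternary a \<longleftrightarrow> a 0"
  using ternary_shift[of a] ternary_bounds[of "\<lambda>k. a (Suc k)"] by (cases "a 0") auto

lemma bit_space_retract_unit_interval:
  obtains \<phi> :: "(nat \<Rightarrow> bool) \<Rightarrow> real" and \<psi>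
  where "\<phi> \<in> borel_measurable bit_space" "\<psi> \<in> borel \<rightarrow>\<^sub>M bit_space"
    "\<And>a. \<phi> a \<in> {0..1}" "\<And>a. \<psi> (\<phi> a) = a"
proof
  \<comment> \<open>Drop the first digit.\<close>
  define s :: "real \<Rightarrow> real" where "s r = (if 1 \<le> 3 * r then 3 * r - 1 else 3 * r)" for r
  define \<psi> where "\<psi> r k \<longleftrightarrow> 1 \<le> 3 * (s ^^ k) r" for r k
  show "ternary \<in> borel_measurable bit_space"
    unfolding ternary_def of_bool_def by measurable
  have [measurable]: "s \<in> borel_measurable borel" unfolding s_def by measurable
  have [measurable]: "(s ^^ k) \<in> borel_measurable borel" for k
    by (induction k) (auto simp: comp_def)
  show "\<psi> \<in> borel \<rightarrow>\<^sub>M bit_space"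
    by (rule measurable_into_bit_space) (simp add: \<psi>_def)
  show "ternary a \<in> {0..1}" for a using ternary_bounds[of a] by auto
  have "(s ^^ k) (ternary a) = ternary (\<lambda>j. a (j + k))" for k a
  proof (induction k)
    case (Suc k)
    then show ?case
      using ternary_shift[of "\<lambda>j. a (j + k)"] ternary_head[of "\<lambda>j. a (j + k)"] by (simp add: s_def)
  qed simp
  then show "\<psi> (ternary a) = a" for a by (simp add: fun_eq_iff \<psi>_def ternary_head)
qed

section \<open>Regular conditional distributions\<close>

text \<open>
  On the set where \<open>g < f\<close> the assumed inequality is an equality of integrals, so the two functions
  agree there almost everywhere, and the set is null. This way no integral has to be subtracted.
\<close>

lemma AE_le_if_set_nn_integral_le:
  assumes "finite_measure M"
    and [measurable]: "f \<in> borel_measurable M" "g \<in> borel_measurable M"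
    and le: "\<And>A. A \<in> sets M \<Longrightarrow> (\<integral>\<^sup>+x\<in>A. f x \<partial>M) \<le> (\<integral>\<^sup>+x\<in>A. g x \<partial>M)"
  shows "AE x in M. f x \<le> (g x :: ennreal)"
proof -
  interpret finite_measure M by fact
  define A where "A = {x \<in> space M. g x < f x}"
  have [measurable]: "A \<in> sets M" unfolding A_def by measurable
  have *: "(\<integral>\<^sup>+x\<in>B. f x * indicator A x \<partial>M) = (\<integral>\<^sup>+x\<in>B. g x * indicator A x \<partial>M)"
    if [measurable]: "B \<in> sets M" for B
  proof (rule antisym)
    have "(\<integral>\<^sup>+x\<in>A \<inter> B. f x \<partial>M) \<le> (\<integral>\<^sup>+x\<in>A \<inter> B. g x \<partial>M)"
      by (rule le) measurable
    then show "(\<integral>\<^sup>+x\<in>B. f x * indicator A x \<partial>M) \<le> (\<integral>\<^sup>+x\<in>B. g x * indicator A x \<partial>M)"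
      by (simp add: indicator_inter_arith mult.assoc)
    show "(\<integral>\<^sup>+x\<in>B. g x * indicator A x \<partial>M) \<le> (\<integral>\<^sup>+x\<in>B. f x * indicator A x \<partial>M)"
      by (intro nn_integral_mono) (auto simp: A_def indicator_def)
  qed
  have "AE x in M. f x * indicator A x = g x * indicator A x"
    by (rule density_unique_finite_measure) (use * in auto)
  then show ?thesis
    by (rule AE_mp) (auto intro!: AE_I2 simp: A_def indicator_def not_less split: if_splits)
qed

lemma emeasure_distr_restrict:
  assumes [measurable]: "T \<in> M \<rightarrow>\<^sub>M N" "A \<in> sets M" "B \<in> sets N"
  shows "emeasure (distr (density M (indicator A)) N T) B = emeasure M (A \<inter> (T -` B \<inter> space M))"
proof -
  have "emeasure (distr (density M (indicator A)) N T) B =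
      (\<integral>\<^sup>+x. indicator (A \<inter> (T -` B \<inter> space M)) x \<partial>M)"
    by (simp add: emeasure_distr emeasure_density indicator_inter_arith[symmetric])
  also have "\<dots> = emeasure M (A \<inter> (T -` B \<inter> space M))"
    by (intro nn_integral_indicator) measurable
  finally show ?thesis .
qed

text \<open>
  The conditional distribution function at a rational \<open>q\<close> is the Radon-Nikodym derivative, with
  respect to the law of \<open>T\<close>, of the part of that law where \<open>\<phi> \<le> q\<close>. These derivatives are monotone
  in \<open>q\<close> only almost everywhere. Taking the infimum over the rationals above \<open>r\<close> gives functions
  that are monotone and right continuous everywhere and have the required integrals.
\<close>

lemma conditional_distribution_unit_interval:
  fixes \<phi> :: "'x \<Rightarrow> real"
  assumes "prob_space M" and T[measurable]: "T \<in> M \<rightarrow>\<^sub>M N"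
    and \<phi>[measurable]: "\<phi> \<in> borel_measurable M"
    and unit: "\<And>x. x \<in> space M \<Longrightarrow> \<phi> x \<in> {0..1}"
  shows "\<exists>K \<in> N \<rightarrow>\<^sub>M prob_algebra borel. \<forall>A\<in>sets borel. \<forall>B\<in>sets N.
    emeasure M (\<phi> -` A \<inter> T -` B \<inter> space M) = (\<integral>\<^sup>+y\<in>B. emeasure (K y) A \<partial>distr M N T)"
proof -
  interpret prob_space M by fact
  define D where "D = distr M N T"
  interpret D: prob_space D unfolding D_def by (rule prob_space_distr) simp
  have [measurable_cong, simp]: "sets D = sets N" and [simp]: "space D = space N"
    by (auto simp: D_def)
  define \<nu> where "\<nu> r = distr (density M (indicator (\<phi> -` {..r} \<inter> space M))) N T" for r
  have sets_nu[simp]: "sets (\<nu> r) = sets N" for r by (simp add: \<nu>_def)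
  have nu: "emeasure (\<nu> r) B = emeasure M (\<phi> -` {..r} \<inter> T -` B \<inter> space M)"
    if [measurable]: "B \<in> sets N" for r B
    unfolding \<nu>_def
    by (subst emeasure_distr_restrict) (auto intro!: arg_cong[where f = "emeasure M"])
  have D: "emeasure D B = emeasure M (T -` B \<inter> space M)" if "B \<in> sets N" for B
    using that by (simp add: D_def emeasure_distr)
  have nu_le: "emeasure (\<nu> q) B \<le> emeasure (\<nu> r) B" if "B \<in> sets N" "q \<le> r" for q r B
    using that by (auto simp: nu intro!: emeasure_mono)
  have nu_le_D: "emeasure (\<nu> r) B \<le> emeasure D B" if "B \<in> sets N" for r B
    using that by (auto simp: nu D intro!: emeasure_mono)
  have ac: "absolutely_continuous D (\<nu> r)" for r
    unfolding absolutely_continuous_def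
  proof
    fix B assume "B \<in> null_sets D"
    then show "B \<in> null_sets (\<nu> r)"
      using nu_le_D[of B r] by (auto simp: null_sets_def)
  qed
  define f where "f r = RN_deriv D (\<nu> r)" for r
  have [measurable]: "f r \<in> borel_measurable N" for r
    using borel_measurable_RN_deriv[of D "\<nu> r"] unfolding f_def by simp
  have f: "(\<integral>\<^sup>+y\<in>B. f r y \<partial>D) = emeasure (\<nu> r) B" if [measurable]: "B \<in> sets N" for r B
    using D.density_RN_deriv[OF ac[of r]] by (simp add: f_def emeasure_density[symmetric])
  have f_le_1: "AE y in D. f r y \<le> 1" for r
    by (rule AE_le_if_set_nn_integral_le) (auto simp: D.finite_measure_axioms f nu_le_D)
  \<comment> \<open>Outside the unit interval the value is prescribed, so that every section is a
    distribution function and no exceptional null set has to be removed.\<close>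
  define g where "g r y = (if r < 0 then 0 else if 1 \<le> r then 1 else enn2real (min 1 (f r y)))" for r y
  have [measurable]: "g r \<in> borel_measurable N" for r unfolding g_def by measurable
  have g01: "0 \<le> g r y" "g r y \<le> 1" for r y
    by (auto simp: g_def intro!: enn2real_leI)
  have g: "(\<integral>\<^sup>+y\<in>B. ennreal (g r y) \<partial>D) = emeasure (\<nu> r) B" if [measurable]: "B \<in> sets N" for r B
  proof -
    consider "r < 0" | "1 \<le> r" | "0 \<le> r" "r < 1" by linarith
    then show ?thesis
    proof cases
      case 1
      have "\<phi> -` {..r} \<inter> T -` B \<inter> space M = {}" using unit 1 by fastforce
      then show ?thesis using 1 by (simp add: nu g_def)
    next
      case 2
      have "\<phi> -` {..r} \<inter> T -` B \<inter> space M = T -` B \<inter> space M" using unit 2 by fastforce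
      then show ?thesis using 2 by (simp add: nu g_def D)
    next
      case 3
      have "(\<integral>\<^sup>+y\<in>B. ennreal (g r y) \<partial>D) = (\<integral>\<^sup>+y\<in>B. f r y \<partial>D)"
        using f_le_1[of r] 3
        by (intro nn_integral_cong_AE)
          (auto elim!: eventually_mono simp: g_def min_def ennreal_enn2real_if top_unique split: if_splits)
      then show ?thesis by (simp add: f)
    qed
  qed
  have g_mono: "AE y in D. g q y \<le> g r y" if "q \<le> r" for q r
  proof -
    have "AE y in D. ennreal (g q y) \<le> ennreal (g r y)"
      by (rule AE_le_if_set_nn_integral_le) (use that in \<open>auto simp: D.finite_measure_axioms g nu_le\<close>)
    then show ?thesis by (simp add: g01)
  qed
  \<comment> \<open>The infimum over all larger rationals is monotone in \<open>r\<close> whatever the values are.\<close>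
  define F where "F y r = (INF q\<in>\<rat> \<inter> {r<..}. g q y)" for y r
  have ne: "\<rat> \<inter> {r<..} \<noteq> {}" for r :: real
    using Rats_no_top_le[of "r + 1"] by force
  have bdd: "bdd_below ((\<lambda>q. g q y) ` (\<rat> \<inter> {r<..}))" for y r
    using g01 by (auto intro!: bdd_belowI[of _ 0])
  have F_le: "F y r \<le> g q y" if "q \<in> \<rat>" "r < q" for y q r
    unfolding F_def using that bdd by (auto intro!: cINF_lower)
  have F_ge: "c \<le> F y r" if "\<And>q. q \<in> \<rat> \<Longrightarrow> r < q \<Longrightarrow> c \<le> g q y" for c y r
    unfolding F_def using that ne by (auto intro!: cINF_greatest)
  have F0: "0 \<le> F y r" for y r by (rule F_ge) (rule g01)
  have F_mono: "F y r \<le> F y s" if "r \<le> s" for y r s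
    using that by (intro F_ge F_le) auto
  have F_neg: "F y r = 0" if "r < 0" for y r
  proof -
    obtain q where "q \<in> \<rat>" "r < q" "q < 0" using Rats_dense_in_real \<open>r < 0\<close> by blast
    then show ?thesis using F_le[of q r y] F0[of y r] by (simp add: g_def)
  qed
  have F_1: "F y r = 1" if "1 \<le> r" for y r
  proof (rule antisym)
    obtain q where "q \<in> \<rat>" "r < q" using ne[of r] by auto
    then show "F y r \<le> 1" using F_le g01(2) order_trans by blast
    show "1 \<le> F y r" using that by (intro F_ge) (auto simp: g_def)
  qed
  have F_right: "continuous (at_right r) (F y)" for y r
  proof (subst continuous_at_right_real_increasing)
    show "\<forall>e>0. \<exists>d>0. F y (r + d) - F y r < e"
    proof (intro allI impI)
      fix e :: real assume "0 < e"
      have "\<exists>q\<in>\<rat> \<inter> {r<..}. g q y < F y r + e"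
        using \<open>0 < e\<close> ne bdd unfolding F_def by (subst cINF_less_iff[symmetric]) auto
      then obtain q where q: "q \<in> \<rat>" "r < q" "g q y < F y r + e" by auto
      then have "F y (r + (q - r) / 2) \<le> g q y" by (intro F_le) (auto simp: field_simps)
      then show "\<exists>d>0. F y (r + d) - F y r < e"
        using q by (intro exI[of _ "(q - r) / 2"]) auto
    qed
  qed (rule F_mono)
  have F_bot: "(F y \<longlongrightarrow> 0) at_bot" for y
    by (rule tendsto_eventually) (auto simp: eventually_at_bot_dense F_neg intro!: exI[of _ 0])
  have F_top: "(F y \<longlongrightarrow> 1) at_top" for y
    by (rule tendsto_eventually) (auto simp: eventually_at_top_linorder F_1 intro!: exI[of _ 1])
  have [measurable]: "(\<lambda>y. F y r) \<in> borel_measurable N" for r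
    unfolding F_def using bdd by (intro borel_measurable_cINF) (auto simp: countable_rat)
  define K where "K y = interval_measure (F y)" for y
  have K_Iic: "emeasure (K y) {..r} = F y r" for y r
    unfolding K_def by (rule emeasure_interval_measure_Iic[OF F_mono F_right F_bot])
  have K: "K \<in> N \<rightarrow>\<^sub>M prob_algebra borel"
  proof (rule measurable_prob_algebra_generated[where G = "range (\<lambda>r. {..r})" and \<Omega> = UNIV])
    show "sets borel = sigma_sets UNIV (range (\<lambda>r::real. {..r}))"
      by (simp add: borel_eq_atMost)
    show "prob_space (K y)" for y
      unfolding K_def
      using real_distribution_interval_measure[OF F_mono F_right F_bot F_top]
      by (simp add: real_distribution_def)
    show "sets (K y) = sets borel" for y by (simp add: K_def)
    show "(\<lambda>y. emeasure (K y) A) \<in> borel_measurable N" if "A \<in> range (\<lambda>r. {..r})" for A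
      using that by (auto simp: K_Iic)
  qed (auto simp: Int_stable_def)
  \<comment> \<open>The law of \<open>\<phi>\<close> on the event that \<open>T\<close> lies in \<open>B\<close>; right continuity of its distribution
    function bounds the integral of \<open>F\<close> from above.\<close>
  define \<sigma> where "\<sigma> B = distr (density M (indicator (T -` B \<inter> space M))) borel \<phi>" for B
  have \<sigma>: "emeasure (\<sigma> B) A = emeasure M (\<phi> -` A \<inter> T -` B \<inter> space M)"
    if [measurable]: "A \<in> sets borel" "B \<in> sets N" for A B
    unfolding \<sigma>_def
    by (subst emeasure_distr_restrict) (auto intro!: arg_cong[where f = "emeasure M"])
  have fin_\<sigma>: "finite_borel_measure (\<sigma> B)" if "B \<in> sets N" for B
    unfolding finite_borel_measure_def finite_borel_measure_axioms_def
  proof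
    show "finite_measure (\<sigma> B)"
      using \<sigma>[of UNIV B] that by (intro finite_measureI) (simp add: \<sigma>_def)
  qed (simp add: \<sigma>_def)
  have nu_cdf: "emeasure (\<nu> r) B = ennreal (cdf (\<sigma> B) r)" if "B \<in> sets N" for B r
  proof -
    interpret finite_borel_measure "\<sigma> B" by (rule fin_\<sigma>) fact
    have "emeasure (\<nu> r) B = emeasure (\<sigma> B) {..r}" using that by (simp add: nu \<sigma>)
    then show ?thesis by (simp add: cdf_def emeasure_eq_measure)
  qed
  have int_F: "(\<integral>\<^sup>+y\<in>B. ennreal (F y r) \<partial>D) = emeasure (\<nu> r) B" if B[measurable]: "B \<in> sets N" for B r
  proof (rule antisym)
    have "AE y in D. \<forall>q\<in>\<rat> \<inter> {r<..}. g r y \<le> g q y"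
      by (subst AE_ball_countable) (auto simp: countable_rat intro!: g_mono)
    then have "AE y in D. g r y \<le> F y r"
      by (rule eventually_mono) (auto intro!: F_ge)
    then have "(\<integral>\<^sup>+y\<in>B. ennreal (g r y) \<partial>D) \<le> (\<integral>\<^sup>+y\<in>B. ennreal (F y r) \<partial>D)"
      by (intro nn_integral_mono_AE) (auto elim!: eventually_mono intro!: mult_right_mono ennreal_leI)
    then show "emeasure (\<nu> r) B \<le> (\<integral>\<^sup>+y\<in>B. ennreal (F y r) \<partial>D)" by (simp add: g)
    interpret \<sigma>: finite_borel_measure "\<sigma> B" by (rule fin_\<sigma>) fact
    show "(\<integral>\<^sup>+y\<in>B. ennreal (F y r) \<partial>D) \<le> emeasure (\<nu> r) B"
    proof (rule ennreal_le_epsilon)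
      fix e :: real assume "0 < e"
      then obtain \<delta> where \<delta>: "\<delta> > 0" "cdf (\<sigma> B) (r + \<delta>) - cdf (\<sigma> B) r < e"
        using \<sigma>.cdf_is_right_cont[of r] \<sigma>.cdf_nondecreasing
        by (subst (asm) continuous_at_right_real_increasing) auto
      obtain q where q: "q \<in> \<rat>" "r < q" "q < r + \<delta>"
        using Rats_dense_in_real[of r "r + \<delta>"] \<delta> by auto
      have "(\<integral>\<^sup>+y\<in>B. ennreal (F y r) \<partial>D) \<le> (\<integral>\<^sup>+y\<in>B. ennreal (g q y) \<partial>D)"
        using q by (intro nn_integral_mono mult_right_mono ennreal_leI F_le) auto
      also have "\<dots> = ennreal (cdf (\<sigma> B) q)" by (simp add: g nu_cdf)
      also have "\<dots> \<le> ennreal (cdf (\<sigma> B) r + e)"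
        using \<sigma>.cdf_nondecreasing[of q "r + \<delta>"] q \<delta> by (intro ennreal_leI) auto
      also have "\<dots> = emeasure (\<nu> r) B + ennreal e"
        using \<open>0 < e\<close> by (simp add: nu_cdf \<sigma>.cdf_nonneg)
      finally show "(\<integral>\<^sup>+y\<in>B. ennreal (F y r) \<partial>D) \<le> emeasure (\<nu> r) B + ennreal e" .
    qed
  qed
  have N_ne: "space N \<noteq> {}" using measurable_space[OF T] not_empty by auto
  have "emeasure M (\<phi> -` A \<inter> T -` B \<inter> space M) = (\<integral>\<^sup>+y\<in>B. emeasure (K y) A \<partial>D)"
    if A: "A \<in> sets borel" and B[measurable]: "B \<in> sets N" for A B
  proof -
    define \<tau> where "\<tau> = density D (indicator B) \<bind> K"
    have K': "K \<in> density D (indicator B) \<rightarrow>\<^sub>M subprob_algebra borel"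
      using measurable_prob_algebraD[OF K] by (simp cong: measurable_cong_sets)
    have [measurable]: "(\<lambda>y. emeasure (K y) A) \<in> borel_measurable N" if "A \<in> sets borel" for A
      using measurable_emeasure_kernel[OF measurable_prob_algebraD[OF K] that] .
    have \<tau>: "emeasure \<tau> A = (\<integral>\<^sup>+y\<in>B. emeasure (K y) A \<partial>D)" if [measurable]: "A \<in> sets borel" for A
      unfolding \<tau>_def using N_ne
      by (subst emeasure_bind[OF _ K']) (auto simp: nn_integral_density mult.commute)
    have sets_\<tau>: "sets \<tau> = sets borel"
      unfolding \<tau>_def using N_ne by (subst sets_bind[where N = borel]) (auto simp: K_def)
    have \<tau>_Iic: "emeasure \<tau> {..r} = ennreal (cdf (\<sigma> B) r)" for r
      by (simp add: \<tau> K_Iic int_F nu_cdf)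
    interpret \<sigma>: finite_borel_measure "\<sigma> B" by (rule fin_\<sigma>) fact
    have "finite_measure \<tau>"
    proof (rule finite_measureI)
      have "emeasure \<tau> UNIV \<le> (\<integral>\<^sup>+y. 1 \<partial>D)"
        using measurable_space[OF K]
        by (subst \<tau>, simp, intro nn_integral_mono)
          (auto simp: indicator_def space_prob_algebra prob_space.emeasure_le_1)
      also have "\<dots> = 1" using D.emeasure_space_1 by simp
      finally show "emeasure \<tau> (space \<tau>) \<noteq> \<infinity>"
        using sets_eq_imp_space_eq[OF sets_\<tau>] by (auto simp: top_unique)
    qed
    then have "finite_borel_measure \<tau>"
      by (simp add: finite_borel_measure_def finite_borel_measure_axioms_def sets_\<tau>)
    then have "\<sigma> B = \<tau>"
      by (intro cdf_unique' fin_\<sigma> B)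
        (auto simp: fun_eq_iff cdf_def[of \<tau>] measure_def[of \<tau>] \<tau>_Iic \<sigma>.cdf_nonneg)
    then show ?thesis using \<sigma>[OF A B] \<tau>[OF A] by simp
  qed
  then show ?thesis using K unfolding D_def by blast
qed

text \<open>
  The kernel for the real-valued code of a point is pushed forward by the decoding map.
\<close>

lemma regular_conditional_distribution:
  assumes "prob_space M" and retract: "measurable_retract M bit_space"
    and T[measurable]: "T \<in> M \<rightarrow>\<^sub>M N"
  shows "\<exists>K \<in> N \<rightarrow>\<^sub>M prob_algebra M. \<forall>A\<in>sets M. \<forall>B\<in>sets N.
    emeasure M (A \<inter> (T -` B \<inter> space M)) = (\<integral>\<^sup>+y\<in>B. emeasure (K y) A \<partial>distr M N T)"
proof -
  obtain \<phi>\<^sub>0 \<psi>\<^sub>0 where \<phi>0[measurable]: "\<phi>\<^sub>0 \<in> M \<rightarrow>\<^sub>M bit_space"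
    and \<psi>0[measurable]: "\<psi>\<^sub>0 \<in> bit_space \<rightarrow>\<^sub>M M"
    and inv0: "\<And>x. x \<in> space M \<Longrightarrow> \<psi>\<^sub>0 (\<phi>\<^sub>0 x) = x"
    using retract unfolding measurable_retract_def by blast
  obtain \<phi>\<^sub>1 :: "(nat \<Rightarrow> bool) \<Rightarrow> real" and \<psi>\<^sub>1
    where \<phi>1[measurable]: "\<phi>\<^sub>1 \<in> borel_measurable bit_space"
      and \<psi>1[measurable]: "\<psi>\<^sub>1 \<in> borel \<rightarrow>\<^sub>M bit_space"
      and unit: "\<And>a. \<phi>\<^sub>1 a \<in> {0..1}" and inv1: "\<And>a. \<psi>\<^sub>1 (\<phi>\<^sub>1 a) = a"
    using bit_space_retract_unit_interval by blast
  have [measurable]: "(\<lambda>x. \<phi>\<^sub>1 (\<phi>\<^sub>0 x)) \<in> borel_measurable M" by measurable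
  have "\<exists>K \<in> N \<rightarrow>\<^sub>M prob_algebra borel. \<forall>A\<in>sets borel. \<forall>B\<in>sets N.
      emeasure M ((\<lambda>x. \<phi>\<^sub>1 (\<phi>\<^sub>0 x)) -` A \<inter> T -` B \<inter> space M) =
      (\<integral>\<^sup>+y\<in>B. emeasure (K y) A \<partial>distr M N T)"
    by (intro conditional_distribution_unit_interval assms(1) T unit) measurable
  then obtain K where K: "K \<in> N \<rightarrow>\<^sub>M prob_algebra borel"
    and cond: "\<forall>A\<in>sets borel. \<forall>B\<in>sets N.
      emeasure M ((\<lambda>x. \<phi>\<^sub>1 (\<phi>\<^sub>0 x)) -` A \<inter> T -` B \<inter> space M) =
      (\<integral>\<^sup>+y\<in>B. emeasure (K y) A \<partial>distr M N T)"
    by (rule bexE)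
  define \<psi> where "\<psi> r = \<psi>\<^sub>0 (\<psi>\<^sub>1 r)" for r
  have \<psi>[measurable]: "\<psi> \<in> borel \<rightarrow>\<^sub>M M" unfolding \<psi>_def by measurable
  have setsK: "sets (K y) = sets borel" if "y \<in> space N" for y
    using measurable_space[OF K that] by (simp add: space_prob_algebra)
  have "emeasure M (A \<inter> (T -` B \<inter> space M)) =
      (\<integral>\<^sup>+y\<in>B. emeasure (distr (K y) M \<psi>) A \<partial>distr M N T)"
    if A[measurable]: "A \<in> sets M" and B: "B \<in> sets N" for A B
  proof -
    have \<psi>A: "\<psi> -` A \<in> sets borel" using measurable_sets[OF \<psi> A] by simp
    have "A \<inter> (T -` B \<inter> space M) = (\<lambda>x. \<phi>\<^sub>1 (\<phi>\<^sub>0 x)) -` (\<psi> -` A) \<inter> T -` B \<inter> space M"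
      by (auto simp: \<psi>_def inv0 inv1)
    then have "emeasure M (A \<inter> (T -` B \<inter> space M)) =
        (\<integral>\<^sup>+y\<in>B. emeasure (K y) (\<psi> -` A) \<partial>distr M N T)"
      using cond \<psi>A B by simp
    also have "\<dots> = (\<integral>\<^sup>+y\<in>B. emeasure (distr (K y) M \<psi>) A \<partial>distr M N T)"
    proof (rule nn_integral_cong)
      fix y assume "y \<in> space (distr M N T)"
      then have y: "y \<in> space N" by simp
      have "\<psi> \<in> K y \<rightarrow>\<^sub>M M" using \<psi> setsK[OF y] by (simp cong: measurable_cong_sets)
      moreover have "space (K y) = UNIV" using sets_eq_imp_space_eq[OF setsK[OF y]] by simp
      ultimately show "emeasure (K y) (\<psi> -` A) * indicator B y =
          emeasure (distr (K y) M \<psi>) A * indicator B y"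
        by (simp add: emeasure_distr)
    qed
    finally show ?thesis .
  qed
  moreover have "(\<lambda>y. distr (K y) M \<psi>) \<in> N \<rightarrow>\<^sub>M prob_algebra M"
    using measurable_compose[OF K measurable_distr_prob_space[OF \<psi>]] .
  ultimately show ?thesis by (intro bexI[of _ "\<lambda>y. distr (K y) M \<psi>"]) auto
qed

section \<open>Sufficiency and likelihood ratios\<close>

text \<open>
  Here \<open>k y\<close> is the conditional probability of \<open>A\<close> given that the statistic takes the value \<open>y\<close>.
\<close>

lemma nn_integral_statistic_conditional:
  assumes [measurable]: "S \<in> P \<rightarrow>\<^sub>M N" "A \<in> sets P" "k \<in> borel_measurable N" "h \<in> borel_measurable N"
    and cond: "\<And>B. B \<in> sets N \<Longrightarrow>
      emeasure P (A \<inter> (S -` B \<inter> space P)) = (\<integral>\<^sup>+y\<in>B. k y \<partial>distr P N S)"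
  shows "(\<integral>\<^sup>+x\<in>A. h (S x) \<partial>P) = (\<integral>\<^sup>+y. k y * h y \<partial>distr P N S)"
proof -
  have eq: "distr (density P (indicator A)) N S = density (distr P N S) k"
    by (rule measure_eqI) (auto simp: emeasure_distr_restrict emeasure_density cond)
  have "(\<integral>\<^sup>+x\<in>A. h (S x) \<partial>P) = (\<integral>\<^sup>+y. h y \<partial>distr (density P (indicator A)) N S)"
    by (simp add: nn_integral_distr nn_integral_density mult.commute)
  then show ?thesis unfolding eq by (simp add: nn_integral_density)
qed

text \<open>
  The direction of the Fisher-Neyman factorization criterion that yields sufficiency. Reweighting
  \<open>M\<close> by a function of \<open>T\<close> changes the law of \<open>T\<close> but not the conditional distribution given \<open>T\<close>, so
  the kernel \<open>K\<close> of \<open>M\<close> serves every \<open>\<theta>\<close>.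
\<close>

lemma sufficient_if_density_factors:
  assumes T[measurable]: "T \<in> M \<rightarrow>\<^sub>M N"
    and K: "K \<in> N \<rightarrow>\<^sub>M prob_algebra M"
    and cond: "\<And>A B. A \<in> sets M \<Longrightarrow> B \<in> sets N \<Longrightarrow>
      emeasure M (A \<inter> (T -` B \<inter> space M)) = (\<integral>\<^sup>+y\<in>B. emeasure (K y) A \<partial>distr M N T)"
    and h: "\<And>\<theta>. \<theta> \<in> \<Theta> \<Longrightarrow> h \<theta> \<in> borel_measurable N"
    and P: "\<And>\<theta>. \<theta> \<in> \<Theta> \<Longrightarrow> P \<theta> = density M (\<lambda>x. h \<theta> (T x))"
  shows "sufficient M \<Theta> P N T"
  unfolding sufficient_def
proof (intro conjI T bexI[OF _ K] ballI)
  fix \<theta> A B assume "\<theta> \<in> \<Theta>" and A[measurable]: "A \<in> sets M" and B[measurable]: "B \<in> sets N"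
  have [measurable]: "h \<theta> \<in> borel_measurable N" by (rule h) fact
  have [measurable]: "(\<lambda>y. emeasure (K y) A) \<in> borel_measurable N"
    using measurable_emeasure_kernel[OF measurable_prob_algebraD[OF K] A] .
  have "emeasure (P \<theta>) (A \<inter> (T -` B \<inter> space M)) =
      (\<integral>\<^sup>+x\<in>A. h \<theta> (T x) * indicator B (T x) \<partial>M)"
    unfolding P[OF \<open>\<theta> \<in> \<Theta>\<close>]
    by (subst emeasure_density) (auto intro!: nn_integral_cong simp: indicator_def)
  also have "\<dots> = (\<integral>\<^sup>+y. emeasure (K y) A * (h \<theta> y * indicator B y) \<partial>distr M N T)"
    by (rule nn_integral_statistic_conditional[where h = "\<lambda>y. h \<theta> y * indicator B y"])
      (auto simp: cond)
  also have "\<dots> = (\<integral>\<^sup>+y\<in>B. emeasure (K y) A \<partial>distr (P \<theta>) N T)"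
    unfolding P[OF \<open>\<theta> \<in> \<Theta>\<close>] by (simp add: nn_integral_distr nn_integral_density ac_simps)
  finally show "emeasure (P \<theta>) (A \<inter> (T -` B \<inter> space M)) =
      (\<integral>\<^sup>+y\<in>B. emeasure (K y) A \<partial>distr (P \<theta>) N T)" .
qed

text \<open>
  Both laws are recovered from the laws of \<open>S\<close> by the same kernel. Hence the density of one law of
  \<open>S\<close> with respect to the other, composed with \<open>S\<close>, is a density of the laws of the sample.
\<close>

lemma sufficient_likelihood_ratio:
  assumes suff: "sufficient M \<Theta> P N S" and \<theta>: "\<theta> \<in> \<Theta>" "\<theta>' \<in> \<Theta>"
    and sets: "sets (P \<theta>) = sets M" "sets (P \<theta>') = sets M"
    and fin: "finite_measure (P \<theta>)"
    and ac: "absolutely_continuous (P \<theta>) (P \<theta>')"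
  shows "\<exists>f \<in> borel_measurable N. P \<theta>' = density (P \<theta>) (\<lambda>x. f (S x))"
proof -
  have space: "space (P \<theta>) = space M" "space (P \<theta>') = space M"
    using sets by (auto dest: sets_eq_imp_space_eq)
  obtain K where S: "S \<in> M \<rightarrow>\<^sub>M N" and K: "K \<in> N \<rightarrow>\<^sub>M prob_algebra M"
    and cond: "\<forall>\<theta>\<in>\<Theta>. \<forall>A\<in>sets M. \<forall>B\<in>sets N.
      emeasure (P \<theta>) (A \<inter> (S -` B \<inter> space M)) = (\<integral>\<^sup>+y\<in>B. emeasure (K y) A \<partial>distr (P \<theta>) N S)"
    using suff unfolding sufficient_def by blast
  have [measurable]: "S \<in> P \<theta> \<rightarrow>\<^sub>M N" "S \<in> P \<theta>' \<rightarrow>\<^sub>M N"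
    using S sets by (auto cong: measurable_cong_sets)
  interpret D: finite_measure "distr (P \<theta>) N S"
    using fin by (rule finite_measure.finite_measure_distr) measurable
  have "absolutely_continuous (distr (P \<theta>) N S) (distr (P \<theta>') N S)"
    unfolding absolutely_continuous_def
  proof
    fix B assume "B \<in> null_sets (distr (P \<theta>) N S)"
    then have "B \<in> sets N" "S -` B \<inter> space M \<in> null_sets (P \<theta>)"
      by (auto simp: null_sets_distr_iff space)
    then show "B \<in> null_sets (distr (P \<theta>') N S)"
      using ac by (auto simp: absolutely_continuous_def null_sets_distr_iff space)
  qed
  then have RN: "density (distr (P \<theta>) N S) (RN_deriv (distr (P \<theta>) N S) (distr (P \<theta>') N S)) = distr (P \<theta>') N S"
    by (rule D.density_RN_deriv) simp
  define f where "f = RN_deriv (distr (P \<theta>) N S) (distr (P \<theta>') N S)"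
  have f[measurable]: "f \<in> borel_measurable N"
    using borel_measurable_RN_deriv[of "distr (P \<theta>) N S"] unfolding f_def by simp
  have "P \<theta>' = density (P \<theta>) (\<lambda>x. f (S x))"
  proof (rule measure_eqI)
    show "sets (P \<theta>') = sets (density (P \<theta>) (\<lambda>x. f (S x)))" using sets by simp
    fix A assume "A \<in> sets (P \<theta>')"
    then have AM: "A \<in> sets M" and [measurable]: "A \<in> sets (P \<theta>)" using sets by auto
    have [measurable]: "(\<lambda>y. emeasure (K y) A) \<in> borel_measurable N"
      using measurable_emeasure_kernel[OF measurable_prob_algebraD[OF K] AM] .
    have "emeasure (P \<theta>') A = emeasure (P \<theta>') (A \<inter> (S -` space N \<inter> space M))"
      using sets.sets_into_space[OF AM] measurable_space[OF S] by (intro arg_cong2[where f = emeasure]) auto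
    also have "\<dots> = (\<integral>\<^sup>+y\<in>space N. emeasure (K y) A \<partial>distr (P \<theta>') N S)"
      using cond \<theta> AM by blast
    also have "\<dots> = (\<integral>\<^sup>+y. emeasure (K y) A \<partial>distr (P \<theta>') N S)"
      by (intro nn_integral_cong) simp
    also have "\<dots> = (\<integral>\<^sup>+y. emeasure (K y) A * f y \<partial>distr (P \<theta>) N S)"
      by (subst RN[symmetric], subst f_def[symmetric]) (simp add: nn_integral_density mult.commute)
    also have "\<dots> = (\<integral>\<^sup>+x\<in>A. f (S x) \<partial>P \<theta>)"
      by (rule nn_integral_statistic_conditional[symmetric]) (use cond \<theta> AM space in auto)
    also have "\<dots> = emeasure (density (P \<theta>) (\<lambda>x. f (S x))) A"
      by (simp add: emeasure_density)
    finally show "emeasure (P \<theta>') A = emeasure (density (P \<theta>) (\<lambda>x. f (S x))) A" .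
  qed
  then show ?thesis using f by blast
qed

section \<open>Exponential families\<close>

lemma openin_Euclidean_space_move_coordinate:
  assumes "openin (Euclidean_space m) U" "u \<in> U" "j < m"
  obtains \<epsilon> where "\<epsilon> > 0" "u(j := u j + \<epsilon>) \<in> U"
proof -
  have u: "u \<in> topspace (Euclidean_space m)" using openin_subset[OF assms(1)] assms(2) by blast
  have cont: "continuous_map euclideanreal (Euclidean_space m) (\<lambda>s. u(j := s))"
    unfolding Euclidean_space_def continuous_map_in_subtopology
  proof
    show "continuous_map euclideanreal (powertop_real UNIV) (\<lambda>s. u(j := s))"
      by (auto simp: continuous_map_componentwise_UNIV fun_upd_def)
    show "(\<lambda>s. u(j := s)) \<in> topspace euclideanreal \<rightarrow> {x. \<forall>i\<ge>m. x i = 0}"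
      using u assms(3) by (auto simp: topspace_Euclidean_space)
  qed
  then have "open {s. u(j := s) \<in> U}"
    using openin_continuous_map_preimage[OF cont assms(1)] by simp
  moreover have "u j \<in> {s. u(j := s) \<in> U}" using assms(2) by simp
  ultimately obtain e where e: "e > 0" "ball (u j) e \<subseteq> {s. u(j := s) \<in> U}"
    by (meson openE)
  then have "u j + e / 2 \<in> ball (u j) e" by (simp add: dist_real_def)
  then show ?thesis using e that[of "e / 2"] by auto
qed

text \<open>
  A nonempty open set of natural parameters contains two points that differ in the coordinate \<open>j\<close> only. The
  logarithm of the likelihood ratio of the corresponding laws is an affine function of \<open>\<tau> j\<close>, and
  it is a function of \<open>S\<close> by sufficiency.
\<close>

lemma exponential_family_statistic_factors:
  fixes \<tau> :: "nat \<Rightarrow> 'x \<Rightarrow> real" and \<eta> :: "'p \<Rightarrow> nat \<Rightarrow> real"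
  assumes "sigma_finite_measure M"
    and \<tau>[measurable]: "\<And>j. j < m \<Longrightarrow> \<tau> j \<in> borel_measurable M"
    and P: "\<And>\<theta>. \<theta> \<in> \<Theta> \<Longrightarrow> P \<theta> = density M (\<lambda>x. ennreal (exp ((\<Sum>j<m. \<eta> \<theta> j * \<tau> j x) - c \<theta>)))"
    and fin: "\<And>\<theta>. \<theta> \<in> \<Theta> \<Longrightarrow> finite_measure (P \<theta>)"
    and U: "openin (Euclidean_space m) U" "U \<noteq> {}"
      "U \<subseteq> (\<lambda>\<theta> j. if j < m then \<eta> \<theta> j else 0) ` \<Theta>"
    and suff: "sufficient M \<Theta> P N S" and j: "j < m"
  shows "\<exists>s \<in> borel_measurable N. AE x in M. \<tau> j x = s (S x)"
proof -
  interpret sigma_finite_measure M by (rule assms(1))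
  define p where "p \<theta> x = exp ((\<Sum>j<m. \<eta> \<theta> j * \<tau> j x) - c \<theta>)" for \<theta> x
  have [measurable]: "p \<theta> \<in> borel_measurable M" for \<theta>
    unfolding p_def by measurable
  have P: "P \<theta> = density M (\<lambda>x. ennreal (p \<theta> x))" if "\<theta> \<in> \<Theta>" for \<theta>
    using P[OF that] by (simp add: p_def)
  obtain u where u: "u \<in> U" using U(2) by blast
  obtain \<epsilon> where \<epsilon>: "\<epsilon> > 0" "u(j := u j + \<epsilon>) \<in> U"
    using openin_Euclidean_space_move_coordinate[OF U(1) u j] by blast
  obtain \<theta> where \<theta>: "\<theta> \<in> \<Theta>" "u = (\<lambda>j. if j < m then \<eta> \<theta> j else 0)"
    using U(3) u by auto
  obtain \<theta>' where \<theta>': "\<theta>' \<in> \<Theta>" "u(j := u j + \<epsilon>) = (\<lambda>j. if j < m then \<eta> \<theta>' j else 0)"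
    using U(3) \<epsilon>(2) by auto
  have diff: "\<eta> \<theta>' i = \<eta> \<theta> i + (if i = j then \<epsilon> else 0)" if "i < m" for i
    using fun_cong[OF \<theta>'(2), of i] that unfolding \<theta>(2) by (auto split: if_splits)
  have shift: "(\<Sum>i<m. \<eta> \<theta>' i * \<tau> i x) = (\<Sum>i<m. \<eta> \<theta> i * \<tau> i x) + \<epsilon> * \<tau> j x" for x
  proof -
    have "(\<Sum>i<m. \<eta> \<theta>' i * \<tau> i x) = (\<Sum>i<m. \<eta> \<theta> i * \<tau> i x + (if i = j then \<epsilon> * \<tau> j x else 0))"
      by (intro sum.cong) (auto simp: diff algebra_simps)
    then show ?thesis using j by (simp add: sum.distrib)
  qed
  have "absolutely_continuous (P \<theta>) (P \<theta>')"
    unfolding absolutely_continuous_def P[OF \<theta>(1)] P[OF \<theta>'(1)]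
    by (auto simp: null_sets_density_iff p_def)
  then obtain f where [measurable]: "f \<in> borel_measurable N"
    and f: "P \<theta>' = density (P \<theta>) (\<lambda>x. f (S x))"
    using sufficient_likelihood_ratio[OF suff \<theta>(1) \<theta>'(1) _ _ fin[OF \<theta>(1)]]
    by (auto simp: P \<theta>(1) \<theta>'(1))
  have [measurable]: "S \<in> M \<rightarrow>\<^sub>M N" using suff by (simp add: sufficient_def)
  have "density M (\<lambda>x. ennreal (p \<theta>' x)) = density M (\<lambda>x. ennreal (p \<theta> x) * f (S x))"
    using f unfolding P[OF \<theta>(1)] P[OF \<theta>'(1)] by (simp add: density_density_eq)
  then have "AE x in M. ennreal (p \<theta>' x) = ennreal (p \<theta> x) * f (S x)"
    by (intro density_unique2) (auto simp: emeasure_density[symmetric])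
  then have "AE x in M. \<tau> j x = (ln (enn2real (f (S x))) + c \<theta>' - c \<theta>) / \<epsilon>"
  proof (rule AE_mp, intro AE_I2 impI)
    fix x assume "ennreal (p \<theta>' x) = ennreal (p \<theta> x) * f (S x)"
    then have "enn2real (ennreal (p \<theta>' x)) = enn2real (ennreal (p \<theta> x) * f (S x))" by simp
    then have "p \<theta>' x = p \<theta> x * enn2real (f (S x))" by (simp add: p_def enn2real_mult)
    then have "enn2real (f (S x)) = p \<theta>' x / p \<theta> x" by (simp add: p_def)
    also have "\<dots> = exp (\<epsilon> * \<tau> j x - c \<theta>' + c \<theta>)"
      by (simp add: p_def exp_diff[symmetric] shift)
    finally show "\<tau> j x = (ln (enn2real (f (S x))) + c \<theta>' - c \<theta>) / \<epsilon>"
      using \<epsilon>(1) by (simp add: field_simps)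
  qed
  then show ?thesis
    by (intro bexI[of _ "\<lambda>y. (ln (enn2real (f y)) + c \<theta>' - c \<theta>) / \<epsilon>"]) auto
qed

lemma PiM_density:
  assumes "finite I" "sigma_finite_measure \<mu>" "sigma_finite_measure (density \<mu> f)"
    and [measurable]: "f \<in> borel_measurable \<mu>"
  shows "(\<Pi>\<^sub>M i\<in>I. density \<mu> f) = density (\<Pi>\<^sub>M i\<in>I. \<mu>) (\<lambda>x. \<Prod>i\<in>I. f (x i))"
proof -
  interpret product_sigma_finite "\<lambda>_. \<mu>" using assms(2) by (simp add: product_sigma_finite_def)
  interpret D: product_sigma_finite "\<lambda>_. density \<mu> f"
    using assms(3) by (simp add: product_sigma_finite_def)
  show ?thesis
  proof (rule D.PiM_eqI[OF assms(1), symmetric])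
    show "sets (density (\<Pi>\<^sub>M i\<in>I. \<mu>) (\<lambda>x. \<Prod>i\<in>I. f (x i))) = sets (\<Pi>\<^sub>M i\<in>I. density \<mu> f)"
      by (simp cong: sets_PiM_cong)
    fix A assume A: "\<And>i. i \<in> I \<Longrightarrow> A i \<in> sets (density \<mu> f)"
    then have [measurable]: "\<And>i. i \<in> I \<Longrightarrow> A i \<in> sets \<mu>" by simp
    have "emeasure (density (\<Pi>\<^sub>M i\<in>I. \<mu>) (\<lambda>x. \<Prod>i\<in>I. f (x i))) (Pi\<^sub>E I A) =
        (\<integral>\<^sup>+x. (\<Prod>i\<in>I. f (x i)) * indicator (Pi\<^sub>E I A) x \<partial>(\<Pi>\<^sub>M i\<in>I. \<mu>))"
      using assms(1) by (intro emeasure_density sets_PiM_I_finite) auto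
    also have "\<dots> = (\<integral>\<^sup>+x. (\<Prod>i\<in>I. f (x i) * indicator (A i) (x i)) \<partial>(\<Pi>\<^sub>M i\<in>I. \<mu>))"
    proof (rule nn_integral_cong)
      fix x assume "x \<in> space (\<Pi>\<^sub>M i\<in>I. \<mu>)"
      then have ext: "x \<in> extensional I" by (simp add: space_PiM PiE_def)
      show "(\<Prod>i\<in>I. f (x i)) * indicator (Pi\<^sub>E I A) x = (\<Prod>i\<in>I. f (x i) * indicator (A i) (x i))"
        using ext assms(1)
        by (cases "\<forall>i\<in>I. x i \<in> A i") (auto simp: PiE_iff indicator_def prod.distrib)
    qed
    also have "\<dots> = (\<Prod>i\<in>I. \<integral>\<^sup>+g. f g * indicator (A i) g \<partial>\<mu>)"
      using assms(1) by (intro product_nn_integral_prod) auto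
    also have "\<dots> = (\<Prod>i\<in>I. emeasure (density \<mu> f) (A i))"
      by (intro prod.cong) (auto simp: emeasure_density)
    finally show "emeasure (density (\<Pi>\<^sub>M i\<in>I. \<mu>) (\<lambda>x. \<Prod>i\<in>I. f (x i))) (Pi\<^sub>E I A) =
        (\<Prod>i\<in>I. emeasure (density \<mu> f) (A i))" .
  qed
qed

section \<open>The harmonic statistic\<close>

lemma index_mat_adjoint:
  assumes "A \<in> carrier_mat d d" "i < d" "j < d"
  shows "mat_adjoint A $$ (i, j) = cnj (A $$ (j, i))"
  using assms by (simp add: mat_adjoint_def mat_of_rows_def conjugate_complex_def)

lemma trace_adjoint_mult:
  assumes "C \<in> carrier_mat d d" "R \<in> carrier_mat d d"
  shows "mat_trace (mat_adjoint C * R) = (\<Sum>i<d. \<Sum>j<d. cnj (C $$ (j, i)) * R $$ (j, i))"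
proof -
  have adj: "mat_adjoint C \<in> carrier_mat d d"
    using assms(1) by (auto simp: mat_adjoint_def)
  have "(mat_adjoint C * R) $$ (i, i) = (\<Sum>j<d. cnj (C $$ (j, i)) * R $$ (j, i))" if "i < d" for i
  proof -
    have "(mat_adjoint C * R) $$ (i, i) = (\<Sum>j<d. mat_adjoint C $$ (i, j) * R $$ (j, i))"
      using adj assms(2) that by (simp add: scalar_prod_def lessThan_atLeast0)
    then show ?thesis using assms(1) that by (simp add: index_mat_adjoint)
  qed
  then show ?thesis using adj by (simp add: mat_trace_def)
qed

lemma harmonic_energy_entries:
  assumes "C \<in> coeff_families \<Lambda> d" "\<And>l. l \<in> \<Lambda> \<Longrightarrow> \<rho> l g \<in> carrier_mat (d l) (d l)"
  shows "harmonic_energy \<Lambda> d \<rho> C g =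
    (\<Sum>l\<in>\<Lambda>. real (d l) * (\<Sum>i<d l. \<Sum>j<d l. Re (cnj (C l $$ (j, i)) * \<rho> l g $$ (j, i))))"
  unfolding harmonic_energy_def
proof (rule sum.cong)
  fix l assume l: "l \<in> \<Lambda>"
  then have "C l \<in> carrier_mat (d l) (d l)" using assms(1) by (auto simp: coeff_families_def)
  then show "real (d l) * Re (mat_trace (mat_adjoint (C l) * \<rho> l g)) =
      real (d l) * (\<Sum>i<d l. \<Sum>j<d l. Re (cnj (C l $$ (j, i)) * \<rho> l g $$ (j, i)))"
    using assms(2)[OF l] by (simp only: trace_adjoint_mult Re_sum)
qed simp

text \<open>
  The energy of a sample, expressed through the value \<open>y\<close> of the harmonic statistic. The adjoint in
  the statistic accounts for the interchanged indices; the conjugation it causes disappears in the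
  real part.
\<close>

definition energy_of_stat ::
    "'l set \<Rightarrow> ('l \<Rightarrow> nat) \<Rightarrow> ('l \<Rightarrow> complex mat) \<Rightarrow> ('l \<Rightarrow> complex mat) \<Rightarrow> real" where
  "energy_of_stat \<Lambda> d C y =
     (\<Sum>l\<in>\<Lambda>. real (d l) * (\<Sum>i<d l. \<Sum>j<d l. Re (C l $$ (j, i) * y l $$ (i, j))))"

lemma sum_harmonic_energy:
  assumes C: "C \<in> coeff_families \<Lambda> d"
    and \<rho>: "\<And>k l. k < n \<Longrightarrow> l \<in> \<Lambda> \<Longrightarrow> \<rho> l (x k) \<in> carrier_mat (d l) (d l)"
  shows "(\<Sum>k<n. harmonic_energy \<Lambda> d \<rho> C (x k)) = energy_of_stat \<Lambda> d C (harmonic_stat n \<Lambda> d \<rho> x)"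
proof -
  have entry: "Re (C l $$ (j, i) * harmonic_stat n \<Lambda> d \<rho> x l $$ (i, j)) =
      (\<Sum>k<n. Re (cnj (C l $$ (j, i)) * \<rho> l (x k) $$ (j, i)))"
    if "l \<in> \<Lambda>" "i < d l" "j < d l" for l i j
  proof -
    have "harmonic_stat n \<Lambda> d \<rho> x l $$ (i, j) = (\<Sum>k<n. cnj (\<rho> l (x k) $$ (j, i)))"
    proof -
      have "harmonic_stat n \<Lambda> d \<rho> x l $$ (i, j) = (\<Sum>k<n. mat_adjoint (\<rho> l (x k)) $$ (i, j))"
        using that by (simp add: harmonic_stat_def)
      also have "\<dots> = (\<Sum>k<n. cnj (\<rho> l (x k) $$ (j, i)))"
        using that by (intro sum.cong refl index_mat_adjoint[OF \<rho>]) auto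
      finally show ?thesis .
    qed
    then have "C l $$ (j, i) * harmonic_stat n \<Lambda> d \<rho> x l $$ (i, j) =
        (\<Sum>k<n. cnj (cnj (C l $$ (j, i)) * \<rho> l (x k) $$ (j, i)))"
      by (simp add: sum_distrib_left)
    then show ?thesis by (simp only: Re_sum cnj.simps)
  qed
  have "(\<Sum>k<n. harmonic_energy \<Lambda> d \<rho> C (x k)) =
      (\<Sum>k<n. \<Sum>l\<in>\<Lambda>. real (d l) * (\<Sum>i<d l. \<Sum>j<d l. Re (cnj (C l $$ (j, i)) * \<rho> l (x k) $$ (j, i))))"
    using C \<rho> by (intro sum.cong harmonic_energy_entries) auto
  also have "\<dots> = (\<Sum>l\<in>\<Lambda>. \<Sum>k<n. real (d l) * (\<Sum>i<d l. \<Sum>j<d l. Re (cnj (C l $$ (j, i)) * \<rho> l (x k) $$ (j, i))))"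
    by (rule sum.swap)
  also have "\<dots> = energy_of_stat \<Lambda> d C (harmonic_stat n \<Lambda> d \<rho> x)"
    unfolding energy_of_stat_def
  proof (rule sum.cong)
    fix l assume l: "l \<in> \<Lambda>"
    let ?e = "\<lambda>k i j. Re (cnj (C l $$ (j, i)) * \<rho> l (x k) $$ (j, i))"
    have "(\<Sum>k<n. real (d l) * (\<Sum>i<d l. \<Sum>j<d l. ?e k i j)) =
        real (d l) * (\<Sum>k<n. \<Sum>i<d l. \<Sum>j<d l. ?e k i j)"
      by (rule sum_distrib_left[symmetric])
    also have "(\<Sum>k<n. \<Sum>i<d l. \<Sum>j<d l. ?e k i j) = (\<Sum>i<d l. \<Sum>k<n. \<Sum>j<d l. ?e k i j)"
      by (rule sum.swap)
    also have "\<dots> = (\<Sum>i<d l. \<Sum>j<d l. \<Sum>k<n. ?e k i j)"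
      by (intro sum.cong refl sum.swap)
    also have "\<dots> = (\<Sum>i<d l. \<Sum>j<d l. Re (C l $$ (j, i) * harmonic_stat n \<Lambda> d \<rho> x l $$ (i, j)))"
      using l by (intro sum.cong refl entry[symmetric]) auto
    finally show "(\<Sum>k<n. real (d l) * (\<Sum>i<d l. \<Sum>j<d l. ?e k i j)) =
        real (d l) * (\<Sum>i<d l. \<Sum>j<d l. Re (C l $$ (j, i) * harmonic_stat n \<Lambda> d \<rho> x l $$ (i, j)))" .
  qed simp
  finally show ?thesis .
qed

lemma space_mat_borel [simp]: "space (mat_borel d) = carrier_mat d d"
  by (simp add: mat_borel_def)

lemma measurable_mat_entry:
  assumes "i < d" "j < d"
  shows "(\<lambda>A. A $$ (i, j)) \<in> borel_measurable (mat_borel d)"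
proof -
  have "(\<lambda>A. \<lambda>ij\<in>{..<d} \<times> {..<d}. A $$ ij) \<in> mat_borel d \<rightarrow>\<^sub>M (\<Pi>\<^sub>M ij\<in>{..<d} \<times> {..<d}. borel)"
    unfolding mat_borel_def by (intro measurable_vimage_algebra1) (auto simp: space_PiM)
  from measurable_compose[OF this measurable_component_singleton[of "(i, j)"]] assms
  show ?thesis by simp
qed

lemma measurable_into_mat_borel:
  assumes "\<And>i j. i < d \<Longrightarrow> j < d \<Longrightarrow> f (i, j) \<in> borel_measurable M"
  shows "(\<lambda>x. mat d d (\<lambda>ij. f ij x)) \<in> M \<rightarrow>\<^sub>M mat_borel d"
  unfolding mat_borel_def
proof (rule measurable_vimage_algebra2)
  have "(\<lambda>x. \<lambda>ij\<in>{..<d} \<times> {..<d}. f ij x) \<in> M \<rightarrow>\<^sub>M (\<Pi>\<^sub>M ij\<in>{..<d} \<times> {..<d}. borel)"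
    using assms by (intro measurable_restrict) auto
  moreover have "(\<lambda>x. \<lambda>ij\<in>{..<d} \<times> {..<d}. mat d d (\<lambda>ij. f ij x) $$ ij) =
      (\<lambda>x. \<lambda>ij\<in>{..<d} \<times> {..<d}. f ij x)"
    by (auto simp: fun_eq_iff)
  ultimately show "(\<lambda>x. \<lambda>ij\<in>{..<d} \<times> {..<d}. mat d d (\<lambda>ij. f ij x) $$ ij)
      \<in> M \<rightarrow>\<^sub>M (\<Pi>\<^sub>M ij\<in>{..<d} \<times> {..<d}. borel)"
    by simp
qed auto

lemma measurable_into_harmonic_stat_space:
  assumes "\<And>l i j. l \<in> \<Lambda> \<Longrightarrow> i < d l \<Longrightarrow> j < d l \<Longrightarrow> f l (i, j) \<in> borel_measurable M"
  shows "(\<lambda>x. \<lambda>l\<in>\<Lambda>. mat (d l) (d l) (\<lambda>ij. f l ij x)) \<in> M \<rightarrow>\<^sub>M harmonic_stat_space \<Lambda> d"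
  unfolding harmonic_stat_space_def
  using assms by (intro measurable_restrict measurable_into_mat_borel) auto

lemma measurable_energy_of_stat:
  "energy_of_stat \<Lambda> d C \<in> borel_measurable (harmonic_stat_space \<Lambda> d)"
proof -
  have "(\<lambda>y. y l $$ (i, j)) \<in> borel_measurable (harmonic_stat_space \<Lambda> d)"
    if "l \<in> \<Lambda>" "i < d l" "j < d l" for l i j
    unfolding harmonic_stat_space_def
    by (rule measurable_compose[where g = "\<lambda>A. A $$ (i, j)" and f = "\<lambda>y. y l" and N = "mat_borel (d l)"])
      (use that in \<open>auto intro: measurable_component_singleton measurable_mat_entry\<close>)
  then show ?thesis
    unfolding energy_of_stat_def
    by (intro borel_measurable_sum borel_measurable_times borel_measurable_const
        measurable_compose[OF _ borel_measurable_Re]) auto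
qed

lemma mem_real_span: "f \<in> F \<Longrightarrow> f \<in> real_span S F"
  unfolding real_span_def by (auto intro!: exI[of _ "{f}"] exI[of _ "\<lambda>_. 1"])

lemma real_span_range_eq_sum:
  assumes "f \<in> real_span S (t ` {..<m::nat})"
  shows "\<exists>a. \<forall>g\<in>S. f g = (\<Sum>j<m. a j * t j g)"
proof -
  obtain B c where B: "finite B" "B \<subseteq> t ` {..<m}" and f: "\<forall>g\<in>S. f g = (\<Sum>b\<in>B. c b * b g)"
    using assms unfolding real_span_def by blast
  then obtain J where J: "J \<subseteq> {..<m}" "inj_on t J" "B = t ` J"
    by (meson subset_image_inj)
  have "f g = (\<Sum>j<m. (if j \<in> J then c (t j) else 0) * t j g)" if "g \<in> S" for g
  proof -
    have "f g = (\<Sum>j\<in>J. c (t j) * t j g)"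
      using f that J(2,3) by (simp add: sum.reindex)
    also have "\<dots> = (\<Sum>j<m. (if j \<in> J then c (t j) else 0) * t j g)"
      using J(1) by (intro sum.mono_neutral_cong_left) auto
    finally show ?thesis .
  qed
  then show ?thesis by (intro exI[of _ "\<lambda>j. if j \<in> J then c (t j) else 0"]) blast
qed

lemma real_span_borel_measurable:
  assumes "f \<in> real_span (space \<mu>) F" "F \<subseteq> borel_measurable \<mu>"
  shows "f \<in> borel_measurable \<mu>"
proof -
  obtain B c where B: "finite B" "B \<subseteq> F" and f: "\<forall>g\<in>space \<mu>. f g = (\<Sum>b\<in>B. c b * b g)"
    using assms(1) unfolding real_span_def by blast
  have "(\<lambda>g. \<Sum>b\<in>B. c b * b g) \<in> borel_measurable \<mu>"
    using B assms(2) by (intro borel_measurable_sum borel_measurable_times) auto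
  then show ?thesis by (subst measurable_cong[of \<mu> f]) (use f in auto)
qed

text \<open>
  Boundedness of the energy makes the single-observation density integrable. With that, the power of
  a density measure is a density measure, and it is finite.
\<close>

lemma sample_law_eq_density:
  assumes "prob_space \<mu>"
    and E[measurable]: "harmonic_energy \<Lambda> d \<rho> C \<in> borel_measurable \<mu>"
    and bound: "\<And>g. g \<in> space \<mu> \<Longrightarrow> harmonic_energy \<Lambda> d \<rho> C g \<le> b"
  shows "sample_law n \<mu> \<Lambda> d \<rho> C = density (\<Pi>\<^sub>M i\<in>{..<n}. \<mu>)
      (\<lambda>x. ennreal (exp ((\<Sum>i<n. harmonic_energy \<Lambda> d \<rho> C (x i)) - real n * log_partition \<mu> \<Lambda> d \<rho> C)))"
    and "finite_measure (sample_law n \<mu> \<Lambda> d \<rho> C)"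
proof -
  interpret prob_space \<mu> by fact
  interpret product: product_sigma_finite "\<lambda>_. \<mu>"
    by (simp add: product_sigma_finite_def sigma_finite_measure_axioms)
  let ?A = "log_partition \<mu> \<Lambda> d \<rho> C"
  let ?p = "\<lambda>g. ennreal (harmonic_density \<mu> \<Lambda> d \<rho> C g)"
  have [measurable]: "?p \<in> borel_measurable \<mu>" unfolding harmonic_density_def by measurable
  have "(\<integral>\<^sup>+g. ?p g \<partial>\<mu>) \<le> (\<integral>\<^sup>+g. ennreal (exp (b - ?A)) \<partial>\<mu>)"
    by (intro nn_integral_mono ennreal_leI) (simp add: harmonic_density_def bound)
  also have "\<dots> < \<infinity>" by (simp add: emeasure_space_1)
  finally have int_p: "(\<integral>\<^sup>+g. ?p g \<partial>\<mu>) < \<infinity>" .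
  interpret D: finite_measure "density \<mu> ?p"
  proof (rule finite_measureI)
    have "emeasure (density \<mu> ?p) (space \<mu>) = (\<integral>\<^sup>+g. ?p g \<partial>\<mu>)"
      by (subst emeasure_density) (auto intro!: nn_integral_cong)
    then show "emeasure (density \<mu> ?p) (space (density \<mu> ?p)) \<noteq> \<infinity>" using int_p by simp
  qed
  have eq: "sample_law n \<mu> \<Lambda> d \<rho> C = density (\<Pi>\<^sub>M i\<in>{..<n}. \<mu>) (\<lambda>x. \<Prod>i<n. ?p (x i))"
    unfolding sample_law_def
    by (intro PiM_density sigma_finite_measure_axioms D.sigma_finite_measure_axioms) auto
  have "(\<Prod>i<n. ?p (x i)) = ennreal (exp ((\<Sum>i<n. harmonic_energy \<Lambda> d \<rho> C (x i)) - real n * ?A))" for x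
    by (simp add: harmonic_density_def prod_ennreal exp_sum[symmetric] sum_subtractf)
  then show law: "sample_law n \<mu> \<Lambda> d \<rho> C = density (\<Pi>\<^sub>M i\<in>{..<n}. \<mu>)
      (\<lambda>x. ennreal (exp ((\<Sum>i<n. harmonic_energy \<Lambda> d \<rho> C (x i)) - real n * ?A)))"
    using eq by simp
  have "emeasure (sample_law n \<mu> \<Lambda> d \<rho> C) (space (sample_law n \<mu> \<Lambda> d \<rho> C)) =
      (\<integral>\<^sup>+x. (\<Prod>i<n. ?p (x i)) \<partial>(\<Pi>\<^sub>M i\<in>{..<n}. \<mu>))"
    unfolding eq space_density by (subst emeasure_density) (auto intro!: nn_integral_cong)
  also have "\<dots> = (\<Prod>i<n. \<integral>\<^sup>+g. ?p g \<partial>\<mu>)"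
    by (rule product.product_nn_integral_prod) auto
  also have "\<dots> \<noteq> \<infinity>" using int_p by (simp add: power_eq_top_ennreal less_top)
  finally show "finite_measure (sample_law n \<mu> \<Lambda> d \<rho> C)" by (rule finite_measureI)
qed

lemma continuous_map_borel_measurable:
  fixes f :: "'g \<Rightarrow> 'b :: topological_space"
  assumes "space \<mu> = topspace X" "sets \<mu> = sigma_sets (topspace X) {U. openin X U}"
    and "continuous_map X euclidean f"
  shows "f \<in> borel_measurable \<mu>"
proof (rule borel_measurableI)
  fix V :: "'b set" assume "open V"
  then have "openin X {x \<in> topspace X. f x \<in> V}"
    using openin_continuous_map_preimage[OF assms(3), of V] by simp
  moreover have "f -` V \<inter> space \<mu> = {x \<in> topspace X. f x \<in> V}" using assms(1) by auto
  ultimately show "f -` V \<inter> space \<mu> \<in> sets \<mu>"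
    unfolding assms(2) by (auto intro: sigma_sets.Basic)
qed

lemma unitary_dual_representative:
  assumes "l \<in> unitary_dual G X" "(d, \<rho>) \<in> l"
  shows "unitary_rep G X (d, \<rho>)"
  using assms by (auto simp: unitary_dual_def quotient_def rep_equiv_def irreps_def)

lemma continuous_map_harmonic_energy:
  assumes "finite \<Lambda>" and C: "C \<in> coeff_families \<Lambda> d"
    and \<rho>: "\<And>l. l \<in> \<Lambda> \<Longrightarrow> unitary_rep G X (d l, \<rho> l)" and X: "topspace X = carrier G"
  shows "continuous_map X euclideanreal (harmonic_energy \<Lambda> d \<rho> C)"
proof -
  have "continuous_map X euclideanreal (\<lambda>g. Re (cnj (C l $$ (j, i)) * \<rho> l g $$ (j, i)))"
    if "l \<in> \<Lambda>" "i < d l" "j < d l" for l i j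
  proof -
    have "continuous_map X euclidean (\<lambda>g. \<rho> l g $$ (j, i))"
      using \<rho>[OF that(1)] that by (simp add: unitary_rep_def)
    moreover have "continuous_map euclidean euclideanreal (\<lambda>z. Re (cnj (C l $$ (j, i)) * z))"
      by (simp add: continuous_intros)
    ultimately show ?thesis
      by (rule continuous_map_compose[unfolded comp_def])
  qed
  then have "continuous_map X euclideanreal (\<lambda>g. \<Sum>l\<in>\<Lambda>. real (d l) *
      (\<Sum>i<d l. \<Sum>j<d l. Re (cnj (C l $$ (j, i)) * \<rho> l g $$ (j, i))))"
    using assms(1) by (intro continuous_map_sum continuous_map_real_mult_left) auto
  then show ?thesis
  proof (rule continuous_map_eq)
    fix g assume "g \<in> topspace X"
    then have "\<rho> l g \<in> carrier_mat (d l) (d l)" if "l \<in> \<Lambda>" for l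
      using \<rho>[OF that] X by (simp add: unitary_rep_def)
    then show "(\<Sum>l\<in>\<Lambda>. real (d l) * (\<Sum>i<d l. \<Sum>j<d l. Re (cnj (C l $$ (j, i)) * \<rho> l g $$ (j, i)))) =
        harmonic_energy \<Lambda> d \<rho> C g"
      by (rule harmonic_energy_entries[OF C, symmetric])
  qed
qed

lemma compact_space_continuous_real_bound:
  assumes "compact_space X" "continuous_map X euclideanreal f"
  obtains b where "\<And>x. x \<in> topspace X \<Longrightarrow> f x \<le> b"
proof -
  have "compact (f ` topspace X)"
    using image_compactin[OF _ assms(2), of "topspace X"] assms(1) by (simp add: compact_space_def)
  then have "bdd_above (f ` topspace X)" by (intro bounded_imp_bdd_above compact_imp_bounded)
  then show ?thesis using that by (auto simp: bdd_above_def)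
qed

lemma measurable_cnj_iff: "(\<lambda>x. cnj (f x)) \<in> borel_measurable M \<longleftrightarrow> f \<in> borel_measurable M"
  unfolding borel_measurable_complex_iff[of f] borel_measurable_complex_iff[of "\<lambda>x. cnj (f x)"] by simp

lemma measurable_harmonic_stat:
  assumes carrier: "\<And>l g. l \<in> \<Lambda> \<Longrightarrow> g \<in> space \<mu> \<Longrightarrow> \<rho> l g \<in> carrier_mat (d l) (d l)"
    and entry: "\<And>l i j. l \<in> \<Lambda> \<Longrightarrow> i < d l \<Longrightarrow> j < d l \<Longrightarrow>
      (\<lambda>g. \<rho> l g $$ (i, j)) \<in> borel_measurable \<mu>"
  shows "harmonic_stat n \<Lambda> d \<rho> \<in> (\<Pi>\<^sub>M i\<in>{..<n}. \<mu>) \<rightarrow>\<^sub>M harmonic_stat_space \<Lambda> d"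
  unfolding harmonic_stat_def
proof (rule measurable_into_harmonic_stat_space, rule borel_measurable_sum)
  fix l i j k assume l: "l \<in> \<Lambda>" and ij: "i < d l" "j < d l" and k: "k \<in> {..<n}"
  have "(\<lambda>x. \<rho> l (x k) $$ (j, i)) \<in> borel_measurable (\<Pi>\<^sub>M i\<in>{..<n}. \<mu>)"
    by (rule measurable_compose[where g = "\<lambda>g. \<rho> l g $$ (j, i)" and f = "\<lambda>x. x k" and N = \<mu>])
      (use l ij k in \<open>auto intro: measurable_component_singleton entry\<close>)
  then have "(\<lambda>x. cnj (\<rho> l (x k) $$ (j, i))) \<in> borel_measurable (\<Pi>\<^sub>M i\<in>{..<n}. \<mu>)"
    by (simp only: measurable_cnj_iff)
  then show "(\<lambda>x. mat_adjoint (\<rho> l (x k)) $$ (i, j)) \<in> borel_measurable (\<Pi>\<^sub>M i\<in>{..<n}. \<mu>)"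
  proof (rule measurable_cong[THEN iffD1, rotated])
    fix x assume "x \<in> space (\<Pi>\<^sub>M i\<in>{..<n}. \<mu>)"
    then have "x k \<in> space \<mu>" using k by (auto simp: space_PiM)
    then show "cnj (\<rho> l (x k) $$ (j, i)) = mat_adjoint (\<rho> l (x k)) $$ (i, j)"
      using index_mat_adjoint[OF carrier[OF l] ij] by simp
  qed
qed

text \<open>
  The real and imaginary parts of the matrix coefficients are combinations of the \<open>t q\<close>, and the
  statistic sums conjugated coefficients over the sample. The coefficients \<open>a\<close> and \<open>b\<close> do not depend
  on the sample, so the statistic is determined by the sums of the \<open>t q\<close>.
\<close>

lemma harmonic_stat_linear_in_sums:
  assumes carrier: "\<And>l g. l \<in> \<Lambda> \<Longrightarrow> g \<in> S \<Longrightarrow> \<rho> l g \<in> carrier_mat (d l) (d l)"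
    and span: "matrix_coefficients \<Lambda> d \<rho> \<subseteq> real_span S (t ` {..<m::nat})"
  shows "\<exists>a b. \<forall>x. (\<forall>k<n. x k \<in> S) \<longrightarrow>
    harmonic_stat n \<Lambda> d \<rho> x = (\<lambda>l\<in>\<Lambda>. mat (d l) (d l) (\<lambda>ij.
      Complex (\<Sum>q<m. a l ij q * (\<Sum>k<n. t q (x k))) (\<Sum>q<m. b l ij q * (\<Sum>k<n. t q (x k)))))"
proof -
  have re: "\<exists>a. \<forall>g\<in>S. Re (\<rho> l g $$ (j, i)) = (\<Sum>q<m. a q * t q g)"
    and im: "\<exists>a. \<forall>g\<in>S. Im (\<rho> l g $$ (j, i)) = (\<Sum>q<m. a q * t q g)"
    if "l \<in> \<Lambda>" "i < d l" "j < d l" for l i j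
  proof -
    have "(\<lambda>g. Re (\<rho> l g $$ (j, i))) \<in> matrix_coefficients \<Lambda> d \<rho>"
      "(\<lambda>g. Im (\<rho> l g $$ (j, i))) \<in> matrix_coefficients \<Lambda> d \<rho>"
      unfolding matrix_coefficients_def using that by blast+
    then show "\<exists>a. \<forall>g\<in>S. Re (\<rho> l g $$ (j, i)) = (\<Sum>q<m. a q * t q g)"
      "\<exists>a. \<forall>g\<in>S. Im (\<rho> l g $$ (j, i)) = (\<Sum>q<m. a q * t q g)"
      using span by (auto intro!: real_span_range_eq_sum)
  qed
  have "\<exists>c. \<forall>g\<in>S. cnj (\<rho> l g $$ (j, i)) =
      Complex (\<Sum>q<m. fst c q * t q g) (\<Sum>q<m. snd c q * t q g)"
    if lij: "l \<in> \<Lambda>" "i < d l" "j < d l" for l i j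
  proof -
    obtain a b where "\<forall>g\<in>S. Re (\<rho> l g $$ (j, i)) = (\<Sum>q<m. a q * t q g)"
      "\<forall>g\<in>S. Im (\<rho> l g $$ (j, i)) = (\<Sum>q<m. b q * t q g)"
      using re[OF lij] im[OF lij] by (elim exE)
    then have "\<forall>g\<in>S. cnj (\<rho> l g $$ (j, i)) = Complex (\<Sum>q<m. a q * t q g) (\<Sum>q<m. (- b q) * t q g)"
      by (simp add: complex_eq_iff sum_negf)
    then show ?thesis by (intro exI[of _ "(a, \<lambda>q. - b q)"]) simp
  qed
  then have "\<forall>p. \<exists>c. fst p \<in> \<Lambda> \<longrightarrow> fst (snd p) < d (fst p) \<longrightarrow> snd (snd p) < d (fst p) \<longrightarrow>
      (\<forall>g\<in>S. cnj (\<rho> (fst p) g $$ (snd (snd p), fst (snd p))) =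
        Complex (\<Sum>q<m. fst c q * t q g) (\<Sum>q<m. snd c q * t q g))"
    by simp
  from choice[OF this] obtain c where c: "\<And>l i j g. l \<in> \<Lambda> \<Longrightarrow> i < d l \<Longrightarrow> j < d l \<Longrightarrow> g \<in> S \<Longrightarrow>
      cnj (\<rho> l g $$ (j, i)) =
        Complex (\<Sum>q<m. fst (c (l, i, j)) q * t q g) (\<Sum>q<m. snd (c (l, i, j)) q * t q g)"
    by auto
  define a b where "a l i j = fst (c (l, i, j))" and "b l i j = snd (c (l, i, j))" for l i j
  have ab: "cnj (\<rho> l g $$ (j, i)) = Complex (\<Sum>q<m. a l i j q * t q g) (\<Sum>q<m. b l i j q * t q g)"
    if "l \<in> \<Lambda>" "i < d l" "j < d l" "g \<in> S" for l i j g
    unfolding a_def b_def using that by (rule c)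
  have stat: "harmonic_stat n \<Lambda> d \<rho> x = (\<lambda>l\<in>\<Lambda>. mat (d l) (d l) (\<lambda>ij.
      Complex (\<Sum>q<m. case_prod (a l) ij q * (\<Sum>k<n. t q (x k)))
        (\<Sum>q<m. case_prod (b l) ij q * (\<Sum>k<n. t q (x k)))))"
    if x: "\<forall>k<n. x k \<in> S" for x
    unfolding harmonic_stat_def
  proof (intro restrict_ext eq_matI)
    fix l i j assume l: "l \<in> \<Lambda>"
    let ?R = "mat (d l) (d l) (\<lambda>ij. Complex (\<Sum>q<m. case_prod (a l) ij q * (\<Sum>k<n. t q (x k)))
        (\<Sum>q<m. case_prod (b l) ij q * (\<Sum>k<n. t q (x k))))"
    assume "i < dim_row ?R" "j < dim_col ?R"
    then have ij: "i < d l" "j < d l" by auto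
    have "(\<Sum>k<n. mat_adjoint (\<rho> l (x k)) $$ (i, j)) =
        (\<Sum>k<n. Complex (\<Sum>q<m. a l i j q * t q (x k)) (\<Sum>q<m. b l i j q * t q (x k)))"
    proof (rule sum.cong)
      fix k assume "k \<in> {..<n}"
      then have "x k \<in> S" using x by simp
      then show "mat_adjoint (\<rho> l (x k)) $$ (i, j) =
          Complex (\<Sum>q<m. a l i j q * t q (x k)) (\<Sum>q<m. b l i j q * t q (x k))"
        using index_mat_adjoint[OF carrier[OF l] ij] ab[OF l ij] by simp
    qed simp
    also have "\<dots> = Complex (\<Sum>k<n. \<Sum>q<m. a l i j q * t q (x k)) (\<Sum>k<n. \<Sum>q<m. b l i j q * t q (x k))"
      by (simp add: complex_eq_iff)
    also have "\<dots> = Complex (\<Sum>q<m. a l i j q * (\<Sum>k<n. t q (x k))) (\<Sum>q<m. b l i j q * (\<Sum>k<n. t q (x k)))"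
      unfolding sum_distrib_left by (intro arg_cong2[where f = Complex] sum.swap)
    finally show "mat (d l) (d l) (\<lambda>ij. \<Sum>k<n. mat_adjoint (\<rho> l (x k)) $$ ij) $$ (i, j) = ?R $$ (i, j)"
      using ij by simp
  qed auto
  show ?thesis
  proof (rule exI[of _ "\<lambda>l. case_prod (a l)"], rule exI[of _ "\<lambda>l. case_prod (b l)"], rule allI, rule impI)
    fix x assume "\<forall>k<n. x k \<in> S"
    then show "harmonic_stat n \<Lambda> d \<rho> x = (\<lambda>l\<in>\<Lambda>. mat (d l) (d l) (\<lambda>ij.
      Complex (\<Sum>q<m. case_prod (a l) ij q * (\<Sum>k<n. t q (x k)))
        (\<Sum>q<m. case_prod (b l) ij q * (\<Sum>k<n. t q (x k)))))"
      by (rule stat)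
  qed
qed

lemma density_cong_on_space:
  assumes "\<And>x. x \<in> space M \<Longrightarrow> f x = g x" "g \<in> borel_measurable M"
  shows "density M f = density M g"
  using assms measurable_cong[of M f g borel] by (intro density_cong) auto

theorem theorem3:
  fixes G :: "('g, 'r) monoid_scheme"
    and X :: "'g topology"
    and k :: nat
    and \<A> :: "'g chart set"
    and \<mu> :: "'g measure"
    and d :: "'g rep set \<Rightarrow> nat"
    and \<rho> :: "'g rep set \<Rightarrow> 'g \<Rightarrow> complex mat"
    and GN :: "'g rep set set"
    and \<Theta> :: "('g rep set \<Rightarrow> complex mat) set"
    and n :: nat
  assumes lie: "lie_group G X k \<A>"
    and compact: "compact_space X"
    and haar: "normalized_haar G X \<mu>"
    and representatives: "\<forall>l\<in>unitary_dual G X. (d l, \<rho> l) \<in> l"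
    and GN: "GN \<subseteq> unitary_dual G X" "finite GN"
    and parameters: "\<Theta> \<subseteq> coeff_families GN d"
    and full_rank: "full_rank \<mu> GN d \<rho> \<Theta>"
    and n: "n \<ge> 1"
  shows "minimal_sufficient TYPE('s)
           (\<Pi>\<^sub>M i\<in>{..<n}. \<mu>) \<Theta> (sample_law n \<mu> GN d \<rho>)
           (harmonic_stat_space GN d) (harmonic_stat n GN d \<rho>)"
proof -
  let ?M = "\<Pi>\<^sub>M i\<in>{..<n}. \<mu>" and ?N = "harmonic_stat_space GN d" and ?T = "harmonic_stat n GN d \<rho>"
  let ?A = "log_partition \<mu> GN d \<rho>"
  have X: "topspace X = carrier G" "Hausdorff_space X" "second_countable X"
    using lie by (auto simp: lie_group_def smooth_manifold_def)
  have \<mu>: "space \<mu> = topspace X" "sets \<mu> = sigma_sets (topspace X) {U. openin X U}"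
    and prob: "prob_space \<mu>"
    using haar by (auto simp: normalized_haar_def)
  interpret \<mu>: prob_space \<mu> by (rule prob)
  interpret M: prob_space ?M by (intro prob_space_PiM prob)
  have rep: "unitary_rep G X (d l, \<rho> l)" if "l \<in> GN" for l
    using unitary_dual_representative GN(1) representatives that by blast
  have carrier: "\<rho> l g \<in> carrier_mat (d l) (d l)" if "l \<in> GN" "g \<in> space \<mu>" for l g
    using rep[OF that(1)] that(2) \<mu>(1) X(1) by (simp add: unitary_rep_def)
  have entry: "(\<lambda>g. \<rho> l g $$ (i, j)) \<in> borel_measurable \<mu>" if "l \<in> GN" "i < d l" "j < d l" for l i j
    using rep[OF that(1)] that(2,3)
    by (intro continuous_map_borel_measurable[OF \<mu>]) (simp add: unitary_rep_def)
  have T: "?T \<in> ?M \<rightarrow>\<^sub>M ?N" by (rule measurable_harmonic_stat[OF carrier entry])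
  have law: "sample_law n \<mu> GN d \<rho> C =
      density ?M (\<lambda>x. ennreal (exp ((\<Sum>i<n. harmonic_energy GN d \<rho> C (x i)) - real n * ?A C)))"
    and fin: "finite_measure (sample_law n \<mu> GN d \<rho> C)" if "C \<in> \<Theta>" for C
  proof -
    have cont: "continuous_map X euclideanreal (harmonic_energy GN d \<rho> C)"
      by (rule continuous_map_harmonic_energy[OF GN(2) _ rep X(1)]) (use that parameters in auto)
    obtain b where "\<And>g. g \<in> topspace X \<Longrightarrow> harmonic_energy GN d \<rho> C g \<le> b"
      using compact_space_continuous_real_bound[OF compact cont] by blast
    then have b: "\<And>g. g \<in> space \<mu> \<Longrightarrow> harmonic_energy GN d \<rho> C g \<le> b" by (simp add: \<mu>(1))
    note E = continuous_map_borel_measurable[OF \<mu> cont]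
    show "sample_law n \<mu> GN d \<rho> C =
      density ?M (\<lambda>x. ennreal (exp ((\<Sum>i<n. harmonic_energy GN d \<rho> C (x i)) - real n * ?A C)))"
      by (rule sample_law_eq_density(1)[OF prob E b])
    show "finite_measure (sample_law n \<mu> GN d \<rho> C)"
      by (rule sample_law_eq_density(2)[OF prob E b])
  qed
  have coord: "x i \<in> space \<mu>" if "x \<in> space ?M" "i < n" for x i
    using that by (auto simp: space_PiM)

  have "topspace X \<noteq> {}" using \<mu>.not_empty \<mu>(1) by simp
  then have "measurable_retract ?M bit_space"
    by (intro measurable_retract_PiM compact_Hausdorff_measurable_retract[OF compact X(2,3) _ \<mu>])
  from regular_conditional_distribution[OF M.prob_space_axioms this T]
  obtain K where K: "K \<in> ?N \<rightarrow>\<^sub>M prob_algebra ?M"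
    and cond: "\<forall>A\<in>sets ?M. \<forall>B\<in>sets ?N.
      emeasure ?M (A \<inter> (?T -` B \<inter> space ?M)) = (\<integral>\<^sup>+y\<in>B. emeasure (K y) A \<partial>distr ?M ?N ?T)"
    by (rule bexE)
  have suff: "sufficient ?M \<Theta> (sample_law n \<mu> GN d \<rho>) ?N ?T"
  proof (rule sufficient_if_density_factors[OF T K])
    show "emeasure ?M (A \<inter> (?T -` B \<inter> space ?M)) = (\<integral>\<^sup>+y\<in>B. emeasure (K y) A \<partial>distr ?M ?N ?T)"
      if "A \<in> sets ?M" "B \<in> sets ?N" for A B using cond that by blast
    show "(\<lambda>y. ennreal (exp (energy_of_stat GN d C y - real n * ?A C))) \<in> borel_measurable ?N"
      if "C \<in> \<Theta>" for C
      using measurable_energy_of_stat[of GN d C] by measurable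
    fix C assume C: "C \<in> \<Theta>"
    have [measurable]: "(\<lambda>x. energy_of_stat GN d C (?T x)) \<in> borel_measurable ?M"
      using measurable_compose[OF T measurable_energy_of_stat] .
    show "sample_law n \<mu> GN d \<rho> C =
        density ?M (\<lambda>x. ennreal (exp (energy_of_stat GN d C (?T x) - real n * ?A C)))"
      unfolding law[OF C]
    proof (rule density_cong_on_space)
      fix x assume "x \<in> space ?M"
      then have "(\<Sum>i<n. harmonic_energy GN d \<rho> C (x i)) = energy_of_stat GN d C (?T x)"
        using C parameters carrier coord by (intro sum_harmonic_energy) auto
      then show "ennreal (exp ((\<Sum>i<n. harmonic_energy GN d \<rho> C (x i)) - real n * ?A C)) =
          ennreal (exp (energy_of_stat GN d C (?T x) - real n * ?A C))"
        by simp
    qed measurable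
  qed

  obtain m t \<eta> U where coords: "real_coordinates (space \<mu>) GN d \<rho> m t \<eta>"
    and U: "openin (Euclidean_space m) U" "U \<noteq> {}"
      "U \<subseteq> (\<lambda>C j. if j < m then \<eta> C j else 0) ` \<Theta>"
    using full_rank unfolding full_rank_def by blast
  have span: "real_span (space \<mu>) (t ` {..<m}) = real_span (space \<mu>) (matrix_coefficients GN d \<rho>)"
    and energy: "\<And>C g. C \<in> coeff_families GN d \<Longrightarrow> g \<in> space \<mu> \<Longrightarrow>
      harmonic_energy GN d \<rho> C g = (\<Sum>j<m. \<eta> C j * t j g)"
    using coords by (auto simp: real_coordinates_def)
  have coeff_meas: "matrix_coefficients GN d \<rho> \<subseteq> borel_measurable \<mu>"
    using entry unfolding matrix_coefficients_def
    by (auto intro: measurable_compose[OF _ borel_measurable_Re] measurable_compose[OF _ borel_measurable_Im])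
  have t: "t j \<in> borel_measurable \<mu>" if "j < m" for j
  proof (rule real_span_borel_measurable[OF _ coeff_meas])
    show "t j \<in> real_span (space \<mu>) (matrix_coefficients GN d \<rho>)"
      using that unfolding span[symmetric] by (intro mem_real_span) auto
  qed
  define \<tau> where "\<tau> j x = (\<Sum>i<n. t j (x i))" for j x
  have \<tau>: "\<tau> j \<in> borel_measurable ?M" if "j < m" for j
    unfolding \<tau>_def
  proof (rule borel_measurable_sum)
    fix i assume "i \<in> {..<n}"
    then have "(\<lambda>x. x i) \<in> ?M \<rightarrow>\<^sub>M \<mu>" by (rule measurable_component_singleton)
    from measurable_compose[OF this t[OF that]] show "(\<lambda>x. t j (x i)) \<in> borel_measurable ?M" .
  qed
  have law_\<tau>: "sample_law n \<mu> GN d \<rho> C =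
      density ?M (\<lambda>x. ennreal (exp ((\<Sum>j<m. \<eta> C j * \<tau> j x) - real n * ?A C)))"
    if "C \<in> \<Theta>" for C
    unfolding law[OF that]
  proof (rule density_cong_on_space)
    fix x assume x: "x \<in> space ?M"
    have "(\<Sum>i<n. harmonic_energy GN d \<rho> C (x i)) = (\<Sum>i<n. \<Sum>j<m. \<eta> C j * t j (x i))"
      using that parameters coord[OF x] by (intro sum.cong refl energy) auto
    also have "\<dots> = (\<Sum>j<m. \<eta> C j * \<tau> j x)"
      unfolding \<tau>_def sum_distrib_left by (rule sum.swap)
    finally show "ennreal (exp ((\<Sum>i<n. harmonic_energy GN d \<rho> C (x i)) - real n * ?A C)) =
        ennreal (exp ((\<Sum>j<m. \<eta> C j * \<tau> j x) - real n * ?A C))" by simp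
  qed (use \<tau> in measurable)
  have sub: "matrix_coefficients GN d \<rho> \<subseteq> real_span (space \<mu>) (t ` {..<m})"
    unfolding span by (auto intro: mem_real_span)
  have "\<exists>a b. \<forall>x. (\<forall>k<n. x k \<in> space \<mu>) \<longrightarrow> ?T x = (\<lambda>l\<in>GN. mat (d l) (d l) (\<lambda>ij.
      Complex (\<Sum>q<m. a l ij q * (\<Sum>k<n. t q (x k))) (\<Sum>q<m. b l ij q * (\<Sum>k<n. t q (x k)))))"
    by (rule harmonic_stat_linear_in_sums[OF carrier sub])
  then obtain a b where "\<forall>x. (\<forall>k<n. x k \<in> space \<mu>) \<longrightarrow> ?T x = (\<lambda>l\<in>GN. mat (d l) (d l) (\<lambda>ij.
      Complex (\<Sum>q<m. a l ij q * (\<Sum>k<n. t q (x k))) (\<Sum>q<m. b l ij q * (\<Sum>k<n. t q (x k)))))"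
    by (elim exE)
  then have T_\<tau>: "?T x = (\<lambda>l\<in>GN. mat (d l) (d l) (\<lambda>ij.
      Complex (\<Sum>q<m. a l ij q * \<tau> q x) (\<Sum>q<m. b l ij q * \<tau> q x)))" if "x \<in> space ?M" for x
    unfolding \<tau>_def using coord[OF that] by simp

  show ?thesis
    unfolding minimal_sufficient_def
  proof (intro conjI allI impI suff)
    fix N' :: "'s measure" and S
    assume S: "sufficient ?M \<Theta> (sample_law n \<mu> GN d \<rho>) N' S"
    have "\<forall>j\<in>{..<m}. \<exists>s. s \<in> borel_measurable N' \<and> (AE x in ?M. \<tau> j x = s (S x))"
    proof
      fix j assume "j \<in> {..<m}"
      then have "\<exists>s \<in> borel_measurable N'. AE x in ?M. \<tau> j x = s (S x)"
        using M.sigma_finite_measure_axioms \<tau> law_\<tau> fin U S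
        by (intro exponential_family_statistic_factors[where \<tau> = \<tau> and \<eta> = \<eta> and U = U and m = m
          and c = "\<lambda>C. real n * ?A C" and P = "sample_law n \<mu> GN d \<rho>" and \<Theta> = \<Theta>]) auto
      then show "\<exists>s. s \<in> borel_measurable N' \<and> (AE x in ?M. \<tau> j x = s (S x))" by blast
    qed
    from bchoice[OF this] obtain s where s: "\<And>j. j < m \<Longrightarrow> s j \<in> borel_measurable N'"
      and "\<And>j. j < m \<Longrightarrow> AE x in ?M. \<tau> j x = s j (S x)"
      by auto
    then have all_s: "AE x in ?M. \<forall>j\<in>{..<m}. \<tau> j x = s j (S x)"
      by (intro AE_finite_allI) auto
    \<comment> \<open>The linear map that sends the vector of the sums \<open>\<tau> q\<close> to the harmonic statistic, applied to the
      functions of \<open>S\<close> that agree with these sums almost surely.\<close>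
    define h where "h y = (\<lambda>l\<in>GN. mat (d l) (d l) (\<lambda>ij.
      Complex (\<Sum>q<m. a l ij q * s q y) (\<Sum>q<m. b l ij q * s q y)))" for y
    have "h \<in> N' \<rightarrow>\<^sub>M ?N"
      unfolding h_def using s
      by (intro measurable_into_harmonic_stat_space)
        (auto simp: borel_measurable_complex_iff)
    moreover have "AE x in sample_law n \<mu> GN d \<rho> C. ?T x = h (S x)" if "C \<in> \<Theta>" for C
    proof -
      have "AE x in ?M. ?T x = h (S x)"
        using all_s
      proof (rule AE_mp, intro AE_I2 impI)
        fix x assume "x \<in> space ?M" and eq: "\<forall>j\<in>{..<m}. \<tau> j x = s j (S x)"
        then show "?T x = h (S x)"
          unfolding h_def by (simp add: T_\<tau>)
      qed
      then show ?thesis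
        unfolding law_\<tau>[OF that] using \<tau> by (subst AE_density) auto
    qed
    ultimately show "\<exists>h \<in> N' \<rightarrow>\<^sub>M ?N. \<forall>C\<in>\<Theta>. AE x in sample_law n \<mu> GN d \<rho> C. ?T x = h (S x)"
      by blast
  qed
qed

end
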